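(* Say that a Banach space $X$ has property (U) if every finite metric space $Y$ that admits, for each $\epsilon > 0$, an embedding into $X$ with distortion $1+\epsilon$ admits an isometric embedding into $X$. The following Banach spaces have property (U): (i) all finite-dimensional Banach spaces; (ii) any Banach space $X$ that is isometrically universal for all finite metric spaces, i.e. such that every finite metric space embeds isometrically into $X$; (iii) all $L_p$ spaces, i.e. $L_p(\mu)$ for $1 \leq p \leq \infty$ and $\mu$ a measure.
   Context: Banach spaces are over $\mathbb{R}$. A map $f: Y \to X$ from a metric space $(Y,d_Y)$ to a metric space $(X, d_X)$ has distortion $K$ if there is some $r > 0$ such that $r\, d_Y(x,y) \leq d_X(f(x),f(y)) \leq rK\, d_Y(x,y)$ for all $x,y \in Y$. Isometric embeddings are distance-preserving maps, not assumed linear. *)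

theory Defs
  imports "HOL-Probability.Essential_Supremum"
begin

section \<open>Embeddings and property (U)\<close>

definition embeds_with_distortion ::
  "'y set \<Rightarrow> ('y \<Rightarrow> 'y \<Rightarrow> real) \<Rightarrow> 'x set \<Rightarrow> ('x \<Rightarrow> 'x \<Rightarrow> real) \<Rightarrow> real \<Rightarrow> bool" where
  "embeds_with_distortion Y dY X dX K \<longleftrightarrow>
     (\<exists>f \<in> Y \<rightarrow> X. \<exists>r>0. \<forall>x\<in>Y. \<forall>y\<in>Y.
        r * dY x y \<le> dX (f x) (f y) \<and> dX (f x) (f y) \<le> r * K * dY x y)"

definition embeds_isometrically ::
  "'y set \<Rightarrow> ('y \<Rightarrow> 'y \<Rightarrow> real) \<Rightarrow> 'x set \<Rightarrow> ('x \<Rightarrow> 'x \<Rightarrow> real) \<Rightarrow> bool" where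
  "embeds_isometrically Y dY X dX \<longleftrightarrow>
     (\<exists>f \<in> Y \<rightarrow> X. \<forall>x\<in>Y. \<forall>y\<in>Y. dX (f x) (f y) = dY x y)"

text \<open>
  A definition cannot quantify over all types, so finite metric spaces have their points in
  \<^typ>\<open>nat\<close>.  Every finite metric space is isometric to one of these; \<open>property_U_any_type\<close> and
  \<open>isometrically_universal_any_type\<close> below give both notions for points of an arbitrary type.

  Both notions depend only on the underlying metric of the Banach space, which is passed as a
  carrier with a distance function: \<^term>\<open>UNIV\<close> with \<^term>\<open>dist\<close> for a type of class
  \<^class>\<open>banach\<close>, and a set of almost-everywhere classes for the spaces $L_p(\mu)$.
\<close>

definition property_U :: "'x set \<Rightarrow> ('x \<Rightarrow> 'x \<Rightarrow> real) \<Rightarrow> bool" where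
  "property_U X dX \<longleftrightarrow>
     (\<forall>(Y :: nat set) dY. Metric_space Y dY \<longrightarrow> finite Y \<longrightarrow>
        (\<forall>\<epsilon>>0. embeds_with_distortion Y dY X dX (1 + \<epsilon>)) \<longrightarrow>
        embeds_isometrically Y dY X dX)"

definition isometrically_universal :: "'x set \<Rightarrow> ('x \<Rightarrow> 'x \<Rightarrow> real) \<Rightarrow> bool" where
  "isometrically_universal X dX \<longleftrightarrow>
     (\<forall>(Y :: nat set) dY. Metric_space Y dY \<longrightarrow> finite Y \<longrightarrow> embeds_isometrically Y dY X dX)"

lemma finite_metric_space_nat_copy:
  assumes "Metric_space Y dY" "finite Y"
  shows "\<exists>h. bij_betw h {0..<card Y} Y \<and> Metric_space {0..<card Y} (\<lambda>x y. dY (h x) (h y))"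
proof -
  interpret Y: Metric_space Y dY by fact
  obtain h where h: "bij_betw h {0..<card Y} Y"
    using ex_bij_betw_nat_finite[OF \<open>finite Y\<close>] by blast
  have hY: "h x \<in> Y" if "x \<in> {0..<card Y}" for x
    using h that by (auto simp: bij_betw_def)
  have inj: "h x = h y \<longleftrightarrow> x = y" if "x \<in> {0..<card Y}" "y \<in> {0..<card Y}" for x y
    using h that by (auto simp: bij_betw_def inj_on_def)
  have "Metric_space {0..<card Y} (\<lambda>x y. dY (h x) (h y))"
  proof
    show "0 \<le> dY (h x) (h y)" for x y by (rule Y.nonneg)
    show "dY (h x) (h y) = dY (h y) (h x)" for x y by (rule Y.commute)
    show "dY (h x) (h y) = 0 \<longleftrightarrow> x = y" if "x \<in> {0..<card Y}" "y \<in> {0..<card Y}" for x y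
      using Y.zero[OF hY hY, OF that] inj[OF that] by blast
    show "dY (h x) (h z) \<le> dY (h x) (h y) + dY (h y) (h z)"
      if "x \<in> {0..<card Y}" "y \<in> {0..<card Y}" "z \<in> {0..<card Y}" for x y z
      by (rule Y.triangle[OF hY hY hY, OF that])
  qed
  with h have "bij_betw h {0..<card Y} Y \<and> Metric_space {0..<card Y} (\<lambda>x y. dY (h x) (h y))"
    by simp
  then show ?thesis by (rule exI[of _ h])
qed

lemma embeds_with_distortion_comp:
  assumes "embeds_with_distortion Y dY X dX K" "h \<in> Z \<rightarrow> Y"
  shows "embeds_with_distortion Z (\<lambda>x y. dY (h x) (h y)) X dX K"
proof -
  obtain f r where f: "f \<in> Y \<rightarrow> X" "r > 0"
    "\<forall>x\<in>Y. \<forall>y\<in>Y. r * dY x y \<le> dX (f x) (f y) \<and> dX (f x) (f y) \<le> r * K * dY x y"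
    using assms(1) unfolding embeds_with_distortion_def by blast
  show ?thesis unfolding embeds_with_distortion_def
    by (rule bexI[of _ "f \<circ> h"], rule exI[of _ r]) (use f assms(2) in \<open>simp_all add: Pi_iff\<close>)
qed

lemma embeds_isometrically_bij:
  assumes "embeds_isometrically Z (\<lambda>x y. dY (h x) (h y)) X dX" "bij_betw h Z Y"
  shows "embeds_isometrically Y dY X dX"
proof -
  obtain f where f: "f \<in> Z \<rightarrow> X" "\<forall>x\<in>Z. \<forall>y\<in>Z. dX (f x) (f y) = dY (h x) (h y)"
    using assms(1) unfolding embeds_isometrically_def by blast
  have g: "inv_into Z h y \<in> Z" "h (inv_into Z h y) = y" if "y \<in> Y" for y
    using assms(2) that by (auto simp: bij_betw_def inv_into_into f_inv_into_f)
  show ?thesis unfolding embeds_isometrically_def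
    by (rule bexI[of _ "f \<circ> inv_into Z h"]) (use f g in \<open>simp_all add: Pi_iff\<close>)
qed

lemma property_U_any_type:
  assumes "property_U X dX" "Metric_space Y dY" "finite Y"
    "\<And>\<epsilon>. \<epsilon> > 0 \<Longrightarrow> embeds_with_distortion Y dY X dX (1 + \<epsilon>)"
  shows "embeds_isometrically Y dY X dX"
proof -
  obtain h where h: "bij_betw h {0..<card Y} Y"
    and m: "Metric_space {0..<card Y} (\<lambda>x y. dY (h x) (h y))"
    using finite_metric_space_nat_copy[OF assms(2,3)] by (elim exE conjE)
  have "h \<in> {0..<card Y} \<rightarrow> Y" using h by (auto simp: bij_betw_def)
  then have "\<forall>\<epsilon>>0. embeds_with_distortion {0..<card Y} (\<lambda>x y. dY (h x) (h y)) X dX (1 + \<epsilon>)"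
    using embeds_with_distortion_comp[where h = h and dY = dY, OF assms(4)] by simp
  then have "embeds_isometrically {0..<card Y} (\<lambda>x y. dY (h x) (h y)) X dX"
    using assms(1) m unfolding property_U_def by simp
  then show ?thesis by (rule embeds_isometrically_bij[where h = h and dY = dY, OF _ h])
qed

lemma isometrically_universal_any_type:
  assumes "isometrically_universal X dX" "Metric_space Y dY" "finite Y"
  shows "embeds_isometrically Y dY X dX"
proof -
  obtain h where h: "bij_betw h {0..<card Y} Y"
    and m: "Metric_space {0..<card Y} (\<lambda>x y. dY (h x) (h y))"
    using finite_metric_space_nat_copy[OF assms(2,3)] by (elim exE conjE)
  show ?thesis
    by (rule embeds_isometrically_bij[where h = h and dY = dY, OF _ h])
       (use assms(1) m in \<open>simp add: isometrically_universal_def\<close>)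
qed


section \<open>The spaces $L_p(\mu)$, $1 \le p \le \infty$, of real-valued functions\<close>

definition Lp_functions :: "ennreal \<Rightarrow> 'c measure \<Rightarrow> ('c \<Rightarrow> real) set" where
  "Lp_functions p M =
     {f \<in> borel_measurable M.
        if p = \<infinity> then esssup M (\<lambda>x. ennreal \<bar>f x\<bar>) < \<infinity>
        else integrable M (\<lambda>x. \<bar>f x\<bar> powr enn2real p)}"

definition Lp_norm :: "ennreal \<Rightarrow> 'c measure \<Rightarrow> ('c \<Rightarrow> real) \<Rightarrow> real" where
  "Lp_norm p M f =
     (if p = \<infinity> then enn2real (esssup M (\<lambda>x. ennreal \<bar>f x\<bar>))
      else (LINT x|M. \<bar>f x\<bar> powr enn2real p) powr (1 / enn2real p))"

definition Lp_rel :: "ennreal \<Rightarrow> 'c measure \<Rightarrow> (('c \<Rightarrow> real) \<times> ('c \<Rightarrow> real)) set" where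
  "Lp_rel p M = {(f, g). f \<in> Lp_functions p M \<and> g \<in> Lp_functions p M \<and> (AE x in M. f x = g x)}"

definition Lp_space :: "ennreal \<Rightarrow> 'c measure \<Rightarrow> ('c \<Rightarrow> real) set set" where
  "Lp_space p M = Lp_functions p M // Lp_rel p M"

text \<open>The choice of representatives is immaterial, see \<open>Lp_dist_class\<close>.\<close>

definition Lp_dist :: "ennreal \<Rightarrow> 'c measure \<Rightarrow> ('c \<Rightarrow> real) set \<Rightarrow> ('c \<Rightarrow> real) set \<Rightarrow> real" where
  "Lp_dist p M A B = Lp_norm p M (\<lambda>x. (SOME f. f \<in> A) x - (SOME g. g \<in> B) x)"

lemma equiv_Lp_rel: "equiv (Lp_functions p M) (Lp_rel p M)"
  by (rule equivI) (auto simp: Lp_rel_def refl_on_def sym_def trans_def)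

lemma Lp_norm_cong_AE:
  assumes [measurable]: "f \<in> borel_measurable M" "g \<in> borel_measurable M"
    and ae: "AE x in M. f x = g x"
  shows "Lp_norm p M f = Lp_norm p M g"
proof -
  have "esssup M (\<lambda>x. ennreal \<bar>f x\<bar>) = esssup M (\<lambda>x. ennreal \<bar>g x\<bar>)"
    unfolding esssup_def using ae by (auto intro!: Limsup_eq)
  moreover have "(LINT x|M. \<bar>f x\<bar> powr enn2real p) = (LINT x|M. \<bar>g x\<bar> powr enn2real p)"
    using ae by (intro integral_cong_AE) auto
  ultimately show ?thesis by (simp add: Lp_norm_def)
qed

lemma Lp_dist_class:
  assumes f: "f \<in> Lp_functions p M" and g: "g \<in> Lp_functions p M"
  shows "Lp_dist p M (Lp_rel p M `` {f}) (Lp_rel p M `` {g}) = Lp_norm p M (\<lambda>x. f x - g x)"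
proof -
  define f' where "f' = (SOME h. h \<in> Lp_rel p M `` {f})"
  define g' where "g' = (SOME h. h \<in> Lp_rel p M `` {g})"
  have "f' \<in> Lp_rel p M `` {f}" unfolding f'_def
    by (rule someI[of _ f]) (use f in \<open>auto simp: Lp_rel_def\<close>)
  moreover have "g' \<in> Lp_rel p M `` {g}" unfolding g'_def
    by (rule someI[of _ g]) (use g in \<open>auto simp: Lp_rel_def\<close>)
  ultimately have *: "f' \<in> Lp_functions p M" "g' \<in> Lp_functions p M"
    "AE x in M. f x = f' x" "AE x in M. g x = g' x"
    by (auto simp: Lp_rel_def)
  have "AE x in M. f' x - g' x = f x - g x" using *(3,4) by auto
  then have "Lp_norm p M (\<lambda>x. f' x - g' x) = Lp_norm p M (\<lambda>x. f x - g x)"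
    using f g *(1,2) by (intro Lp_norm_cong_AE) (auto simp: Lp_functions_def)
  then show ?thesis by (simp add: Lp_dist_def f'_def g'_def)
qed

end

theory Submission
  imports Defs
begin

text \<open>
  In a finite-dimensional space, rescaled and translated embeddings of distortion tending to 1 have
  bounded coordinates, so a subsequence converges to an isometric embedding.

  For $L_p(\mu)$ with $p < \infty$, the matrices $(\|f_y - f_z\|^p)_{y,z \in Y}$ lie in the cone of
  finite sums $\sum_k |a_k(y) - a_k(z)|^p$ with $a_k : Y \to \mathbb{R}$: this is clear for simple
  functions, and the cone is closed, because by Caratheodory's theorem the number of summands can be
  bounded in terms of $|Y|$.  The $p$-th powers of the limit distances therefore lie in the cone, and
  such a finite sum is realised in $L_p(\mu)$ whenever $\mu$ has enough disjoint sets of positive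
  finite measure.  If it does not, a maximal disjoint family consists of atoms and $L_p(\mu)$ is
  finite-dimensional.  For $p = \infty$ the same dichotomy, with sets of positive measure, gives either
  the Frechet embedding of $Y$ into $\ell_\infty^{|Y|}$ or again a finite-dimensional space.
\<close>

section \<open>Finite-dimensional spaces\<close>

text \<open>Approximate embeddings into \<open>X'\<close> are composed with \<open>f\<close>, and
  the exact embedding found in \<open>X\<close> is brought back by \<open>g\<close>. The two maps
  need not be inverse to each other, so coordinates can stand for vectors and representatives for
  almost-everywhere classes.\<close>

lemma property_U_transfer:
  assumes "property_U X dX"
    and f: "f \<in> X' \<rightarrow> X" "\<And>x y. x \<in> X' \<Longrightarrow> y \<in> X' \<Longrightarrow> dX (f x) (f y) = dX' x y"
    and g: "g \<in> X \<rightarrow> X'" "\<And>x y. x \<in> X \<Longrightarrow> y \<in> X \<Longrightarrow> dX' (g x) (g y) = dX x y"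
  shows "property_U X' dX'"
  unfolding property_U_def
proof (intro allI impI)
  fix Y :: "nat set" and dY
  assume Y: "Metric_space Y dY" "finite Y"
    and *: "\<forall>\<epsilon>>0. embeds_with_distortion Y dY X' dX' (1 + \<epsilon>)"
  have "embeds_with_distortion Y dY X dX (1 + \<epsilon>)" if "\<epsilon> > 0" for \<epsilon>
  proof -
    obtain h r where h: "h \<in> Y \<rightarrow> X'" "r > 0" "\<forall>x\<in>Y. \<forall>y\<in>Y.
        r * dY x y \<le> dX' (h x) (h y) \<and> dX' (h x) (h y) \<le> r * (1 + \<epsilon>) * dY x y"
      using * \<open>\<epsilon> > 0\<close> unfolding embeds_with_distortion_def by blast
    show ?thesis unfolding embeds_with_distortion_def
      by (rule bexI[of _ "f \<circ> h"], rule exI[of _ r]) (use h f in \<open>simp_all add: Pi_iff\<close>)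
  qed
  then have "embeds_isometrically Y dY X dX"
    using assms(1) Y unfolding property_U_def by blast
  then obtain h where h: "h \<in> Y \<rightarrow> X" "\<forall>x\<in>Y. \<forall>y\<in>Y. dX (h x) (h y) = dY x y"
    unfolding embeds_isometrically_def by blast
  show "embeds_isometrically Y dY X' dX'" unfolding embeds_isometrically_def
    by (rule bexI[of _ "g \<circ> h"]) (use h g in \<open>simp_all add: Pi_iff\<close>)
qed

text \<open>Composing with the scaling \<open>mul (1 / r)\<close> removes the unknown factor
  \<open>r\<close>, and \<epsilon> = 1/(n+1) squeezes the distances. The scaling is a parameter so
  that coordinate vectors and functions are both covered.\<close>

lemma embeds_with_distortion_limit:
  fixes Y :: "'y set" and X :: "'x set"
  assumes emb: "\<And>\<epsilon>. \<epsilon> > 0 \<Longrightarrow> embeds_with_distortion Y dY X dX (1 + \<epsilon>)"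
    and mul: "\<And>t x. t > 0 \<Longrightarrow> x \<in> X \<Longrightarrow> mul t x \<in> X"
      "\<And>t x y. t > 0 \<Longrightarrow> x \<in> X \<Longrightarrow> y \<in> X \<Longrightarrow> dX (mul t x) (mul t y) = t * dX x y"
  obtains f :: "nat \<Rightarrow> 'y \<Rightarrow> 'x"
  where "\<And>n. f n \<in> Y \<rightarrow> X"
    "\<And>y z. y \<in> Y \<Longrightarrow> z \<in> Y \<Longrightarrow> (\<lambda>n. dX (f n y) (f n z)) \<longlonglongrightarrow> dY y z"
proof -
  have "\<exists>g\<in>Y \<rightarrow> X. \<forall>y\<in>Y. \<forall>z\<in>Y. dY y z \<le> dX (g y) (g z) \<and>
      dX (g y) (g z) \<le> (1 + inverse (real (Suc n))) * dY y z" for n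
  proof -
    have "inverse (real (Suc n)) > 0" by simp
    from emb[OF this] obtain h r where h: "h \<in> Y \<rightarrow> X" "r > 0" "\<forall>x\<in>Y. \<forall>y\<in>Y.
        r * dY x y \<le> dX (h x) (h y) \<and> dX (h x) (h y) \<le> r * (1 + inverse (real (Suc n))) * dY x y"
      unfolding embeds_with_distortion_def by blast
    have "dY y z \<le> dX (mul (1 / r) (h y)) (mul (1 / r) (h z)) \<and>
        dX (mul (1 / r) (h y)) (mul (1 / r) (h z)) \<le> (1 + inverse (real (Suc n))) * dY y z"
      if "y \<in> Y" "z \<in> Y" for y z
    proof -
      have "dX (mul (1 / r) (h y)) (mul (1 / r) (h z)) = 1 / r * dX (h y) (h z)"
        using h that by (intro mul(2)) auto
      then show ?thesis
        using h(2) h(3)[rule_format, OF that] by (simp add: pos_le_divide_eq pos_divide_le_eq ac_simps)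
    qed
    moreover have "(\<lambda>y. mul (1 / r) (h y)) \<in> Y \<rightarrow> X"
      using h by (auto intro!: mul(1))
    ultimately show ?thesis by (intro bexI[of _ "\<lambda>y. mul (1 / r) (h y)"]) auto
  qed
  then have "\<exists>g. \<forall>n. g n \<in> Y \<rightarrow> X \<and> (\<forall>y\<in>Y. \<forall>z\<in>Y. dY y z \<le> dX (g n y) (g n z) \<and>
      dX (g n y) (g n z) \<le> (1 + inverse (real (Suc n))) * dY y z)"
    by (intro choice) blast
  then obtain g where g: "\<And>n. g n \<in> Y \<rightarrow> X"
    "\<And>n y z. y \<in> Y \<Longrightarrow> z \<in> Y \<Longrightarrow> dY y z \<le> dX (g n y) (g n z) \<and>
      dX (g n y) (g n z) \<le> (1 + inverse (real (Suc n))) * dY y z"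
    by blast
  show thesis
  proof
    show "g n \<in> Y \<rightarrow> X" for n by (fact g(1))
    fix y z assume yz: "y \<in> Y" "z \<in> Y"
    show "(\<lambda>n. dX (g n y) (g n z)) \<longlonglongrightarrow> dY y z"
    proof (rule tendsto_sandwich)
      show "\<forall>\<^sub>F n in sequentially. dY y z \<le> dX (g n y) (g n z)"
        "\<forall>\<^sub>F n in sequentially. dX (g n y) (g n z) \<le> (1 + inverse (real (Suc n))) * dY y z"
        using g(2)[OF yz] by (auto simp del: of_nat_Suc)
      show "(\<lambda>n. (1 + inverse (real (Suc n))) * dY y z) \<longlonglongrightarrow> dY y z"
        using tendsto_mult_right[OF LIMSEQ_inverse_real_of_nat_add, of "1" "dY y z"] by simp
    qed simp
  qed
qed

section \<open>Compactness in finitely many coordinates\<close>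

lemma finite_bounded_convergent_subseq:
  fixes u :: "nat \<Rightarrow> 'i \<Rightarrow> real"
  assumes "finite I" "\<And>i. i \<in> I \<Longrightarrow> Bseq (\<lambda>n. u n i)"
  shows "\<exists>s l. strict_mono (s :: nat \<Rightarrow> nat) \<and> (\<forall>i\<in>I. (\<lambda>n. u (s n) i) \<longlonglongrightarrow> l i)"
  using assms
proof (induction I rule: finite_induct)
  case empty
  then show ?case using strict_mono_id by auto
next
  case (insert x F)
  then obtain s l where s: "strict_mono (s :: nat \<Rightarrow> nat)"
      "\<forall>i\<in>F. (\<lambda>n. u (s n) i) \<longlonglongrightarrow> l i"
    by auto
  have "bounded (range (\<lambda>n. u (s n) x))"
    using insert.prems[of x] by (auto simp: Bseq_def bounded_iff)
  then obtain m t where t: "strict_mono (t :: nat \<Rightarrow> nat)" "((\<lambda>n. u (s n) x) \<circ> t) \<longlonglongrightarrow> m"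
    using bounded_imp_convergent_subsequence by blast
  have "(\<lambda>n. u ((s \<circ> t) n) i) \<longlonglongrightarrow> (l(x := m)) i" if "i \<in> insert x F" for i
    using that t(2) LIMSEQ_subseq_LIMSEQ[OF s(2)[rule_format] t(1)] insert.hyps
    by (cases "i = x") (auto simp: o_def)
  then show ?case using strict_mono_o[OF s(1) t(1)] by blast
qed

text \<open>The l1 unit sphere is compact: if no \<open>C\<close> worked, normalised counterexamples
  would subconverge to a point of the sphere at which \<open>N\<close> vanishes, against
  \<open>definite\<close>.\<close>

lemma coordinates_bounded_by_norm:
  fixes N :: "('j \<Rightarrow> real) \<Rightarrow> real"
  assumes "finite J"
    and nonneg: "\<And>a. N a \<ge> 0"
    and hom: "\<And>t a. t > 0 \<Longrightarrow> N (\<lambda>j. t * a j) = t * N a"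
    and definite: "\<And>a j. N a = 0 \<Longrightarrow> j \<in> J \<Longrightarrow> a j = 0"
    and cont: "\<And>a l. (\<And>j. j \<in> J \<Longrightarrow> (\<lambda>n. a n j) \<longlonglongrightarrow> l j) \<Longrightarrow> (\<lambda>n. N (a n)) \<longlonglongrightarrow> N l"
  shows "\<exists>C. \<forall>a. (\<Sum>j\<in>J. \<bar>a j\<bar>) \<le> C * N a"
proof (rule ccontr)
  assume "\<not> ?thesis"
  then have "\<exists>a. (\<Sum>j\<in>J. \<bar>a j\<bar>) > C * N a" for C
    by (metis not_le)
  then have "\<exists>a. \<forall>n :: nat. (\<Sum>j\<in>J. \<bar>a n j\<bar>) > real (Suc n) * N (a n)"
    by (intro choice) blast
  then obtain a where a: "\<And>n :: nat. (\<Sum>j\<in>J. \<bar>a n j\<bar>) > real (Suc n) * N (a n)"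
    by blast
  define S where "S n = (\<Sum>j\<in>J. \<bar>a n j\<bar>)" for n
  \<comment> \<open>The strict inequality and \<open>N (a n) \<ge> 0\<close> give positivity, so
    \<open>a n\<close> can be normalised to l1 norm 1.\<close>
  have S: "S n > 0" for n
    using a[of n] nonneg[of "a n"] unfolding S_def
    by (smt (verit) mult_nonneg_nonneg of_nat_0_le_iff)
  define b where "b n j = 1 / S n * a n j" for n j
  have b1: "(\<Sum>j\<in>J. \<bar>b n j\<bar>) = 1" for n
  proof -
    have "(\<Sum>j\<in>J. \<bar>b n j\<bar>) = (\<Sum>j\<in>J. 1 / S n * \<bar>a n j\<bar>)"
      using S[of n] by (simp add: b_def abs_mult)
    also have "\<dots> = 1 / S n * S n" unfolding S_def sum_distrib_left ..
    finally show ?thesis using S[of n] by simp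
  qed
  have bN: "N (b n) \<le> inverse (real (Suc n))" for n
  proof -
    have "N (b n) = 1 / S n * N (a n)"
      unfolding b_def by (rule hom) (use S[of n] in simp)
    also have "\<dots> \<le> inverse (real (Suc n))"
      using a[of n] S[of n] by (simp add: S_def[symmetric] field_simps)
    finally show ?thesis .
  qed
  have "\<bar>b n j\<bar> \<le> 1" if "j \<in> J" for n j
    using member_le_sum[of j J "\<lambda>j. \<bar>b n j\<bar>"] that \<open>finite J\<close> b1[of n] by simp
  then have "Bseq (\<lambda>n. b n j)" if "j \<in> J" for j
    using that by (intro BseqI'[of _ 1]) auto
  from finite_bounded_convergent_subseq[of J b, OF \<open>finite J\<close> this]
  obtain s l where s: "strict_mono (s :: nat \<Rightarrow> nat)"
    "\<And>j. j \<in> J \<Longrightarrow> (\<lambda>n. b (s n) j) \<longlonglongrightarrow> l j" by blast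
  have "(\<lambda>n. N (b n)) \<longlonglongrightarrow> 0"
    by (rule tendsto_sandwich[OF _ _ tendsto_const LIMSEQ_inverse_real_of_nat])
      (use nonneg bN in auto)
  from LIMSEQ_subseq_LIMSEQ[OF this s(1)] have "(\<lambda>n. N (b (s n))) \<longlonglongrightarrow> 0"
    by (simp add: o_def)
  with cont[of "\<lambda>n. b (s n)" l] s(2) have "N l = 0"
    using LIMSEQ_unique by blast
  then have "(\<Sum>j\<in>J. \<bar>l j\<bar>) = 0" using definite by (intro sum.neutral) auto
  moreover have "(\<lambda>n. \<Sum>j\<in>J. \<bar>b (s n) j\<bar>) \<longlonglongrightarrow> (\<Sum>j\<in>J. \<bar>l j\<bar>)"
    by (intro tendsto_sum tendsto_rabs s(2))
  ultimately show False using b1 LIMSEQ_unique[OF tendsto_const] by fastforce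
qed

text \<open>Vectors are given by their coordinates in \<open>J\<close>; by \<open>cont\<close>,
  \<open>N\<close> ignores all others. One statement then serves for Banach spaces with a basis and
  for spaces of step functions.\<close>

lemma property_U_finite_dim:
  fixes N :: "('j \<Rightarrow> real) \<Rightarrow> real"
  assumes "finite J"
    and nonneg: "\<And>a. N a \<ge> 0"
    and hom: "\<And>t a. t > 0 \<Longrightarrow> N (\<lambda>j. t * a j) = t * N a"
    and definite: "\<And>a j. N a = 0 \<Longrightarrow> j \<in> J \<Longrightarrow> a j = 0"
    and cont: "\<And>a l. (\<And>j. j \<in> J \<Longrightarrow> (\<lambda>n. a n j) \<longlonglongrightarrow> l j) \<Longrightarrow> (\<lambda>n. N (a n)) \<longlonglongrightarrow> N l"
  shows "property_U UNIV (\<lambda>a b. N (\<lambda>j. a j - b j))"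
  unfolding property_U_def
proof (intro allI impI)
  fix Y :: "nat set" and dY
  let ?d = "\<lambda>a b. N (\<lambda>j. a j - b j)"
  assume Y: "Metric_space Y dY" "finite Y"
    and *: "\<forall>\<epsilon>>0. embeds_with_distortion Y dY UNIV ?d (1 + \<epsilon>)"
  have "\<exists>C. \<forall>a. (\<Sum>j\<in>J. \<bar>a j\<bar>) \<le> C * N a"
    by (rule coordinates_bounded_by_norm; fact)
  then obtain C where C: "\<And>a. (\<Sum>j\<in>J. \<bar>a j\<bar>) \<le> C * N a" by blast
  have sc: "?d (\<lambda>j. t * a j) (\<lambda>j. t * b j) = t * ?d a b" if "t > 0" for t a b
    using hom[OF that, of "\<lambda>j. a j - b j"] by (simp add: algebra_simps)
  obtain f where f: "\<And>y z. y \<in> Y \<Longrightarrow> z \<in> Y \<Longrightarrow> (\<lambda>n :: nat. ?d (f n y) (f n z)) \<longlonglongrightarrow> dY y z"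
    using embeds_with_distortion_limit[of Y dY UNIV ?d "\<lambda>t a j. t * a j"] * sc by auto
  show "embeds_isometrically Y dY UNIV ?d"
  proof (cases "Y = {}")
    case False
    then obtain y0 where y0: "y0 \<in> Y" by auto
    \<comment> \<open>Translating the image of \<open>y0\<close> to 0 bounds the coordinates: they
      are dominated by \<open>C\<close> times the distance to the image of \<open>y0\<close>, and
      these distances converge.\<close>
    define u where "u n = (\<lambda>(y, j). f n y j - f n y0 j)" for n
    have "Bseq (\<lambda>n. u n i)" if iYJ: "i \<in> Y \<times> J" for i
    proof -
      obtain y j where i: "i = (y, j)" "y \<in> Y" "j \<in> J" using iYJ by blast
      have "Bseq (\<lambda>n. ?d (f n y) (f n y0))"
        using f[OF i(2) y0] by (metis convergent_imp_Bseq convergentI)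
      then have "Bseq (\<lambda>n. C * ?d (f n y) (f n y0))" by (rule Bseq_mult[OF Bfun_const])
      moreover have "\<bar>u n i\<bar> \<le> C * ?d (f n y) (f n y0)" for n
      proof -
        have "\<bar>u n i\<bar> \<le> (\<Sum>j\<in>J. \<bar>f n y j - f n y0 j\<bar>)"
          using i \<open>finite J\<close> member_le_sum[of j J "\<lambda>j. \<bar>f n y j - f n y0 j\<bar>"]
          by (simp add: u_def)
        also have "\<dots> \<le> C * ?d (f n y) (f n y0)" by (rule C)
        finally show ?thesis .
      qed
      ultimately show ?thesis
        unfolding Bseq_def by (metis abs_ge_self order_trans real_norm_def)
    qed
    from finite_bounded_convergent_subseq[of "Y \<times> J" u, OF finite_cartesian_product[OF Y(2) \<open>finite J\<close>] this]
    obtain s l where s: "strict_mono (s :: nat \<Rightarrow> nat)"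
      "\<And>i. i \<in> Y \<times> J \<Longrightarrow> (\<lambda>n. u (s n) i) \<longlonglongrightarrow> l i"
      by blast
    have "?d (\<lambda>j. l (y, j)) (\<lambda>j. l (z, j)) = dY y z" if "y \<in> Y" "z \<in> Y" for y z
    proof (rule LIMSEQ_unique)
      \<comment> \<open>The base point terms cancel in differences, so \<open>u (s n)\<close> and
        \<open>f (s n)\<close> have the same distances.\<close>
      have "(\<lambda>n. N (\<lambda>j. u (s n) (y, j) - u (s n) (z, j))) \<longlonglongrightarrow> N (\<lambda>j. l (y, j) - l (z, j))"
        using s(2) that by (intro cont tendsto_diff) auto
      then show "(\<lambda>n. ?d (f (s n) y) (f (s n) z)) \<longlonglongrightarrow> N (\<lambda>j. l (y, j) - l (z, j))"
        by (simp add: u_def)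
      show "(\<lambda>n. ?d (f (s n) y) (f (s n) z)) \<longlonglongrightarrow> dY y z"
        using LIMSEQ_subseq_LIMSEQ[OF f[OF that] s(1)] by (simp add: o_def)
    qed
    then show ?thesis unfolding embeds_isometrically_def
      by (intro bexI[of _ "\<lambda>y j. l (y, j)"]) auto
  qed (simp add: embeds_isometrically_def)
qed

lemma property_U_finite_span:
  fixes B :: "'a::real_normed_vector set"
  assumes "finite B" "span B = UNIV"
  shows "property_U (UNIV :: 'a set) dist"
proof -
  \<comment> \<open>The spanning set is thinned to a basis to make the coordinate norm
    definite.\<close>
  obtain J where J: "J \<subseteq> B" "independent J" "B \<subseteq> span J"
    by (rule maximal_independent_subset)
  have "finite J" using J(1) \<open>finite B\<close> finite_subset by blast
  have "span J = UNIV" using J(3) assms(2) by (metis span_mono span_span top.extremum_unique)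
  define T where "T a = (\<Sum>b\<in>J. a b *\<^sub>R b)" for a
  have "\<exists>a. x = T a" for x
    using span_finite[OF \<open>finite J\<close>] \<open>span J = UNIV\<close> unfolding T_def by blast
  then obtain c where c: "\<And>x. T (c x) = x" by metis
  have diff: "norm (T (\<lambda>j. a j - b j)) = dist (T a) (T b)" for a b
    by (simp add: T_def dist_norm scaleR_diff_left sum_subtractf)
  have "property_U UNIV (\<lambda>a b. norm (T (\<lambda>j. a j - b j)))"
  proof (rule property_U_finite_dim[OF \<open>finite J\<close>])
    fix t :: real and a assume "t > 0"
    have "T (\<lambda>j. t * a j) = t *\<^sub>R T a" by (simp add: T_def scaleR_sum_right)
    then show "norm (T (\<lambda>j. t * a j)) = t * norm (T a)" using \<open>t > 0\<close> by simp
  next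
    fix a j assume "norm (T a) = 0" "j \<in> J"
    then show "a j = 0" using independentD[OF J(2) \<open>finite J\<close> subset_refl, of a j] by (simp add: T_def)
  next
    fix a :: "nat \<Rightarrow> 'a \<Rightarrow> real" and l
    assume "\<And>j. j \<in> J \<Longrightarrow> (\<lambda>n. a n j) \<longlonglongrightarrow> l j"
    then show "(\<lambda>n. norm (T (a n))) \<longlonglongrightarrow> norm (T l)"
      unfolding T_def by (intro tendsto_intros) auto
  qed simp
  then show ?thesis
    by (rule property_U_transfer[where f = c and g = T]) (simp_all add: diff c)
qed

section \<open>The cone of $p$-th powers of $L_p$ distances\<close>

text \<open>Gaussian elimination, one coordinate of \<open>P\<close> at a time. The vectors are
  indexed by \<open>K\<close>, so repeated vectors count separately, as they must when summands are
  counted.\<close>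

lemma exists_linear_relation:
  fixes v :: "'k \<Rightarrow> 'q \<Rightarrow> real"
  assumes "finite P" "finite K" "card P < card K"
  shows "\<exists>c. (\<exists>k\<in>K. c k \<noteq> 0) \<and> (\<forall>q\<in>P. (\<Sum>k\<in>K. c k * v k q) = 0)"
  using assms
proof (induction P arbitrary: K v rule: finite_induct)
  case empty
  then obtain k where "k \<in> K" by fastforce
  then show ?case by (intro exI[of _ "\<lambda>_. 1"]) auto
next
  case (insert p F)
  show ?case
  proof (cases "\<forall>k\<in>K. v k p = 0")
    case True
    moreover have "card F < card K" using insert.prems insert.hyps by simp
    ultimately show ?thesis using insert.IH[OF insert.prems(1), of v] by auto
  next
    case False
    then obtain k0 where k0: "k0 \<in> K" "v k0 p \<noteq> 0" by auto
    let ?K = "K - {k0}"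
    \<comment> \<open>Subtracts the multiple of the pivot vector \<open>v k0\<close> that clears
      coordinate \<open>p\<close>.\<close>
    define w where "w k q = v k q - v k p / v k0 p * v k0 q" for k q
    have "card F < card ?K" using insert.prems insert.hyps k0 by simp
    then obtain c where c: "\<exists>k\<in>?K. c k \<noteq> 0" "\<And>q. q \<in> F \<Longrightarrow> (\<Sum>k\<in>?K. c k * w k q) = 0"
      using insert.IH[of ?K w] insert.prems by auto
    \<comment> \<open>This pivot coefficient collects the subtracted multiples. It settles
      coordinate \<open>p\<close> directly and the others through the relation among the
      \<open>w k\<close>.\<close>
    define e where "e = - (\<Sum>k\<in>?K. c k * (v k p / v k0 p))"
    have split: "(\<Sum>k\<in>K. (c(k0 := e)) k * v k q) = e * v k0 q + (\<Sum>k\<in>?K. c k * v k q)" for q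
    proof -
      have "(\<Sum>k\<in>?K. (c(k0 := e)) k * v k q) = (\<Sum>k\<in>?K. c k * v k q)"
        by (rule sum.cong) auto
      then show ?thesis using sum.remove[OF insert.prems(1) k0(1)] by (metis fun_upd_same)
    qed
    have e: "e * v k0 q = - (\<Sum>k\<in>?K. c k * (v k p / v k0 p * v k0 q))" for q
      by (simp add: e_def sum_distrib_right mult.assoc)
    have "(\<Sum>k\<in>K. (c(k0 := e)) k * v k q) = 0" if "q \<in> insert p F" for q
    proof (cases "q = p")
      case True
      then show ?thesis unfolding split e using k0(2) by simp
    next
      case False
      then have "(\<Sum>k\<in>?K. c k * w k q) = 0" using c(2) that by simp
      then show ?thesis unfolding split e w_def by (simp add: right_diff_distrib sum_subtractf)
    qed
    moreover have "\<exists>k\<in>K. (c(k0 := e)) k \<noteq> 0" using c(1) by auto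
    ultimately show ?thesis by blast
  qed
qed

text \<open>While there are more vectors than coordinates, a multiple of a linear relation can be
  subtracted from the weights until one of them reaches 0; that vector is dropped and the induction
  on \<open>K\<close> continues.\<close>

lemma conic_caratheodory:
  fixes v :: "'k \<Rightarrow> 'q \<Rightarrow> real"
  assumes "finite P" "finite K" "\<And>k. k \<in> K \<Longrightarrow> 0 \<le> w k"
  shows "\<exists>K' w'. K' \<subseteq> K \<and> card K' \<le> card P \<and> (\<forall>k\<in>K'. 0 \<le> w' k) \<and>
    (\<forall>q\<in>P. (\<Sum>k\<in>K'. w' k * v k q) = (\<Sum>k\<in>K. w k * v k q))"
  using assms(2,3)
proof (induction K arbitrary: w rule: finite_psubset_induct)
  case (psubset K)
  show ?case
  proof (cases "card K \<le> card P")
    case True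
    then show ?thesis using psubset.prems by blast
  next
    case False
    then obtain c0 where c0: "\<exists>k\<in>K. c0 k \<noteq> 0" "\<And>q. q \<in> P \<Longrightarrow> (\<Sum>k\<in>K. c0 k * v k q) = 0"
      using exists_linear_relation[OF \<open>finite P\<close> \<open>finite K\<close>, of v] by auto
    \<comment> \<open>A nonzero relation without positive coefficients is replaced by its
      negative.\<close>
    obtain c where c: "\<exists>k\<in>K. c k > 0" "\<And>q. q \<in> P \<Longrightarrow> (\<Sum>k\<in>K. c k * v k q) = 0"
    proof (cases "\<exists>k\<in>K. c0 k > 0")
      case True
      then show ?thesis using c0 that by blast
    next
      case False
      show ?thesis
        by (rule that[of "\<lambda>k. - c0 k"]) (use False c0 in \<open>auto simp: sum_negf\<close>, force)
    qed
    let ?S = "{k\<in>K. c k > 0}"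
    \<comment> \<open>The minimal ratio is the largest multiple of \<open>c\<close> that leaves all
      weights nonnegative; at a minimiser \<open>k0\<close> the new weight is 0.\<close>
    define t where "t = Min ((\<lambda>k. w k / c k) ` ?S)"
    have S: "finite ?S" "?S \<noteq> {}" using \<open>finite K\<close> c(1) by auto
    then have "t \<in> (\<lambda>k. w k / c k) ` ?S" unfolding t_def by (intro Min_in) auto
    then obtain k0 where k0: "k0 \<in> K" "c k0 > 0" "t = w k0 / c k0" by auto
    have "t \<ge> 0" using k0 psubset.prems[of k0] by simp
    have nonneg: "w k - t * c k \<ge> 0" if "k \<in> K" for k
    proof (cases "c k > 0")
      case True
      then have "t \<le> w k / c k" unfolding t_def using S that by (intro Min_le) auto
      then show ?thesis using True by (simp add: pos_le_divide_eq)
    next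
      case False
      then have "t * c k \<le> 0" using \<open>t \<ge> 0\<close> by (simp add: mult_nonneg_nonpos)
      then show ?thesis using psubset.prems[OF that] by simp
    qed
    have "K - {k0} \<subset> K" using k0 by auto
    from psubset.IH[OF this, of "\<lambda>k. w k - t * c k"] nonneg
    obtain K' w' where K': "K' \<subseteq> K - {k0}" "card K' \<le> card P" "\<forall>k\<in>K'. 0 \<le> w' k"
      "\<forall>q\<in>P. (\<Sum>k\<in>K'. w' k * v k q) = (\<Sum>k\<in>K - {k0}. (w k - t * c k) * v k q)"
      by auto
    have "(\<Sum>k\<in>K - {k0}. (w k - t * c k) * v k q) = (\<Sum>k\<in>K. w k * v k q)" if "q \<in> P" for q
    proof -
      \<comment> \<open>The term at \<open>k0\<close> vanishes because
        \<open>w k0 = t * c k0\<close>.\<close>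
      have "(\<Sum>k\<in>K - {k0}. (w k - t * c k) * v k q) = (\<Sum>k\<in>K. (w k - t * c k) * v k q)"
        using k0 \<open>finite K\<close> by (subst sum.remove[of K k0]) auto
      also have "\<dots> = (\<Sum>k\<in>K. w k * v k q) - t * (\<Sum>k\<in>K. c k * v k q)"
        by (simp add: left_diff_distrib sum_subtractf sum_distrib_left mult.assoc)
      finally show ?thesis using c(2)[OF that] by simp
    qed
    with K' show ?thesis by (intro exI[of _ K'] exI[of _ w']) auto
  qed
qed

text \<open>For p > 0 these are the p-th powers of the distances induced by maps of \<open>Y\<close>
  into l_p spaces of arbitrary finite dimension. Weights are omitted, since a factor
  \<open>w powr (1 / p)\<close> in \<open>a k\<close> has the effect of a weight
  \<open>w\<close>.\<close>

definition power_cone :: "real \<Rightarrow> 'y set \<Rightarrow> ('y \<Rightarrow> 'y \<Rightarrow> real) set" where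
  "power_cone p Y =
     {D. \<exists>m (a :: nat \<Rightarrow> 'y \<Rightarrow> real). \<forall>y\<in>Y. \<forall>z\<in>Y. D y z = (\<Sum>k<m. \<bar>a k y - a k z\<bar> powr p)}"

text \<open>Weights move into the functions as factors \<open>w v powr (1 / p)\<close>, and zero
  functions pad the list up to length \<open>m\<close>.\<close>

lemma power_sum_reindex:
  fixes a :: "'v \<Rightarrow> 'y \<Rightarrow> real"
  assumes "p > 0" "finite V" "card V \<le> m" "\<And>v. v \<in> V \<Longrightarrow> w v \<ge> 0"
  shows "\<exists>b. \<forall>y z. (\<Sum>v\<in>V. w v * \<bar>a v y - a v z\<bar> powr p) = (\<Sum>k<m. \<bar>b k y - b k z\<bar> powr p)"
proof -
  obtain h where h: "bij_betw h {..<card V} V"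
    using ex_bij_betw_nat_finite[OF \<open>finite V\<close>] by (auto simp: lessThan_atLeast0)
  define b where "b k y = (if k < card V then w (h k) powr (1 / p) * a (h k) y else 0)" for k y
  have "(\<Sum>v\<in>V. w v * \<bar>a v y - a v z\<bar> powr p) = (\<Sum>k<m. \<bar>b k y - b k z\<bar> powr p)" for y z
  proof -
    have "(\<Sum>v\<in>V. w v * \<bar>a v y - a v z\<bar> powr p)
        = (\<Sum>k<card V. w (h k) * \<bar>a (h k) y - a (h k) z\<bar> powr p)"
      by (rule sum.reindex_bij_betw[OF h, symmetric])
    also have "\<dots> = (\<Sum>k<card V. \<bar>b k y - b k z\<bar> powr p)"
    proof (rule sum.cong)
      fix k assume "k \<in> {..<card V}"
      then have "h k \<in> V" using h by (auto simp: bij_betw_def)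
      then have "w (h k) \<ge> 0" by (rule assms(4))
      have "\<bar>b k y - b k z\<bar> = w (h k) powr (1 / p) * \<bar>a (h k) y - a (h k) z\<bar>"
        using \<open>k \<in> {..<card V}\<close> by (simp add: b_def right_diff_distrib[symmetric] abs_mult)
      then show "w (h k) * \<bar>a (h k) y - a (h k) z\<bar> powr p = \<bar>b k y - b k z\<bar> powr p"
        using \<open>w (h k) \<ge> 0\<close> \<open>p > 0\<close> by (simp add: powr_mult powr_powr)
    qed simp
    also have "\<dots> = (\<Sum>k<m. \<bar>b k y - b k z\<bar> powr p)"
      using \<open>card V \<le> m\<close> \<open>p > 0\<close> by (intro sum.mono_neutral_left) (auto simp: b_def)
    finally show ?thesis .
  qed
  then show ?thesis by blast
qed

lemma power_coneI:
  assumes "p > 0" "finite V" "\<And>v. v \<in> V \<Longrightarrow> w v \<ge> 0"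
    and D: "\<And>y z. y \<in> Y \<Longrightarrow> z \<in> Y \<Longrightarrow> D y z = (\<Sum>v\<in>V. w v * \<bar>a v y - a v z\<bar> powr p)"
  shows "D \<in> power_cone p Y"
proof -
  obtain b where "\<And>y z. (\<Sum>v\<in>V. w v * \<bar>a v y - a v z\<bar> powr p) = (\<Sum>k<card V. \<bar>b k y - b k z\<bar> powr p)"
    using power_sum_reindex[of p V "card V" w a] assms(1-3) by blast
  then show ?thesis
    unfolding power_cone_def using D by (intro CollectI exI[of _ "card V"] exI[of _ b]) auto
qed

text \<open>Caratheodory's theorem for vectors with coordinates in \<open>Y \<times> Y\<close>. A
  length depending on \<open>Y\<close> alone is what permits passing to the limit in
  \<open>power_cone_closed\<close>.\<close>

lemma power_cone_bounded_length:
  assumes "p > 0" "finite Y" "D \<in> power_cone p Y"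
  shows "\<exists>b. \<forall>y\<in>Y. \<forall>z\<in>Y. D y z = (\<Sum>k<card (Y \<times> Y). \<bar>b k y - b k z\<bar> powr p)"
proof -
  obtain m :: nat and a where a: "\<And>y z. y \<in> Y \<Longrightarrow> z \<in> Y \<Longrightarrow> D y z = (\<Sum>k<m. \<bar>a k y - a k z\<bar> powr p)"
    using assms(3) unfolding power_cone_def by auto
  have "finite (Y \<times> Y)" using \<open>finite Y\<close> by simp
  from conic_caratheodory[OF this, of "{..<m}" "\<lambda>_. 1" "\<lambda>k (y, z). \<bar>a k y - a k z\<bar> powr p"]
  obtain K w where K: "K \<subseteq> {..<m}" "card K \<le> card (Y \<times> Y)" "\<forall>k\<in>K. 0 \<le> w k"
    "\<forall>y\<in>Y. \<forall>z\<in>Y. (\<Sum>k\<in>K. w k * \<bar>a k y - a k z\<bar> powr p) = (\<Sum>k<m. \<bar>a k y - a k z\<bar> powr p)"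
    by auto
  then have "finite K" using finite_subset by blast
  with power_sum_reindex[OF \<open>p > 0\<close> this K(2), of w a] K(3)
  obtain b where b: "\<forall>y z. (\<Sum>k\<in>K. w k * \<bar>a k y - a k z\<bar> powr p)
      = (\<Sum>k<card (Y \<times> Y). \<bar>b k y - b k z\<bar> powr p)"
    by blast
  show ?thesis
  proof (intro exI[of _ b] ballI)
    fix y z assume yz: "y \<in> Y" "z \<in> Y"
    then have "D y z = (\<Sum>k\<in>K. w k * \<bar>a k y - a k z\<bar> powr p)" using a K(4) by simp
    then show "D y z = (\<Sum>k<card (Y \<times> Y). \<bar>b k y - b k z\<bar> powr p)" using b by simp
  qed
qed

lemma power_cone_closed:
  assumes "p > 0" "finite Y" and D: "\<And>n :: nat. D n \<in> power_cone p Y"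
    and lim: "\<And>y z. y \<in> Y \<Longrightarrow> z \<in> Y \<Longrightarrow> (\<lambda>n. D n y z) \<longlonglongrightarrow> E y z"
  shows "E \<in> power_cone p Y"
proof (cases "Y = {}")
  case True
  then show ?thesis by (simp add: power_cone_def)
next
  case False
  then obtain y0 where y0: "y0 \<in> Y" by auto
  let ?m = "card (Y \<times> Y)"
  have "\<exists>b. \<forall>n. \<forall>y\<in>Y. \<forall>z\<in>Y. D n y z = (\<Sum>k<?m. \<bar>b n k y - b n k z\<bar> powr p)"
    using power_cone_bounded_length[OF assms(1,2) D] by (intro choice) auto
  then obtain b where b: "\<And>n y z. y \<in> Y \<Longrightarrow> z \<in> Y \<Longrightarrow>
      D n y z = (\<Sum>k<?m. \<bar>b n k y - b n k z\<bar> powr p)"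
    by blast
  \<comment> \<open>Subtracting the value at \<open>y0\<close> changes no difference, and it bounds
    every value: \<open>\<bar>u n (k, y)\<bar> powr p\<close> is one summand of the convergent
    \<open>D n y y0\<close>. Compactness then applies to the parameters.\<close>
  define u where "u n = (\<lambda>(k, y). b n k y - b n k y0)" for n
  have bounded: "Bseq (\<lambda>n. u n i)" if iI: "i \<in> {..<?m} \<times> Y" for i
  proof -
    obtain k y where i: "i = (k, y)" "k < ?m" "y \<in> Y" using iI by blast
    have "Bseq (\<lambda>n. D n y y0)"
      using lim[OF i(3) y0] by (metis convergent_imp_Bseq convergentI)
    then obtain C where C: "\<And>n. \<bar>D n y y0\<bar> \<le> C" by (auto simp: Bseq_def)
    have "\<bar>u n i\<bar> \<le> C powr (1 / p)" for n
    proof -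
      have "\<bar>u n i\<bar> powr p \<le> (\<Sum>k<?m. \<bar>b n k y - b n k y0\<bar> powr p)"
        using i member_le_sum[of k "{..<?m}" "\<lambda>k. \<bar>b n k y - b n k y0\<bar> powr p"] by (simp add: u_def)
      also have "\<dots> \<le> C" using b[OF i(3) y0, of n] C[of n] by simp
      finally have "(\<bar>u n i\<bar> powr p) powr (1 / p) \<le> C powr (1 / p)"
        using \<open>p > 0\<close> by (intro powr_mono2) auto
      then show ?thesis using \<open>p > 0\<close> by (simp add: powr_powr)
    qed
    then show ?thesis by (intro BseqI') auto
  qed
  have "finite ({..<?m} \<times> Y)" using \<open>finite Y\<close> by simp
  from finite_bounded_convergent_subseq[of _ u, OF this bounded]
  obtain s l where s: "strict_mono (s :: nat \<Rightarrow> nat)"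
    "\<And>i. i \<in> {..<?m} \<times> Y \<Longrightarrow> (\<lambda>n. u (s n) i) \<longlonglongrightarrow> l i" by blast
  have "E y z = (\<Sum>k<?m. \<bar>l (k, y) - l (k, z)\<bar> powr p)" if yz: "y \<in> Y" "z \<in> Y" for y z
  proof (rule LIMSEQ_unique)
    show "(\<lambda>n. D (s n) y z) \<longlonglongrightarrow> E y z"
      using LIMSEQ_subseq_LIMSEQ[OF lim[OF yz] s(1)] by (simp add: o_def)
    have "(\<lambda>n. \<Sum>k<?m. \<bar>u (s n) (k, y) - u (s n) (k, z)\<bar> powr p)
        \<longlonglongrightarrow> (\<Sum>k<?m. \<bar>l (k, y) - l (k, z)\<bar> powr p)"
      using \<open>p > 0\<close> yz
      by (intro tendsto_sum tendsto_powr' tendsto_rabs tendsto_diff tendsto_const s(2)) auto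
    then show "(\<lambda>n. D (s n) y z) \<longlonglongrightarrow> (\<Sum>k<?m. \<bar>l (k, y) - l (k, z)\<bar> powr p)"
      by (simp add: u_def b[OF yz])
  qed
  then show ?thesis unfolding power_cone_def by (intro CollectI exI[of _ ?m] exI[of _ "\<lambda>k y. l (k, y)"]) auto
qed

text \<open>The joint level sets cut the space into finitely many pieces on which every
  \<open>G y\<close> is constant, so the integral is a finite sum weighted by the measures of the
  pieces.\<close>

lemma simple_function_distances_in_power_cone:
  fixes G :: "'y \<Rightarrow> 'c \<Rightarrow> real"
  assumes "p > 0" "finite Y" and G: "\<And>y. y \<in> Y \<Longrightarrow> simple_function M (G y)"
    and int: "\<And>y. y \<in> Y \<Longrightarrow> integrable M (\<lambda>x. \<bar>G y x\<bar> powr p)"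
  shows "(\<lambda>y z. LINT x|M. \<bar>G y x - G z x\<bar> powr p) \<in> power_cone p Y"
proof -
  \<comment> \<open>Restricting to \<open>Y\<close> leaves finitely many value vectors, each
    determined by its entries on \<open>Y\<close>.\<close>
  define g where "g x = restrict (\<lambda>y. G y x) Y" for x
  define S where "S v = {x\<in>space M. \<forall>y\<in>Y. G y x = v y}" for v
  let ?V = "g ` space M"
  have "?V \<subseteq> PiE Y (\<lambda>y. G y ` space M)" by (auto simp: g_def)
  moreover have "finite (PiE Y (\<lambda>y. G y ` space M))"
    using \<open>finite Y\<close> G by (intro finite_PiE) (auto simp: simple_function_def)
  ultimately have V: "finite ?V" by (rule finite_subset)
  have Gm: "G y \<in> borel_measurable M" if "y \<in> Y" for y
    using G[OF that] by (rule borel_measurable_simple_function)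
  have S: "S v \<in> sets M" for v
    unfolding S_def using \<open>finite Y\<close> Gm
    by (intro sets.sets_Collect_finite_All borel_measurable_eq) auto
  \<comment> \<open>Integrability of \<open>\<bar>G u x\<bar> powr p\<close> makes such a level set
    finite in measure. The piece where all functions vanish may have infinite measure, but there the
    coefficient \<open>\<bar>v y - v z\<bar> powr p\<close> is 0.\<close>
  have ind: "integrable M (indicat_real (S v))" if u: "u \<in> Y" "v u \<noteq> 0" for v u
  proof (rule Bochner_Integration.integrable_bound)
    show "integrable M (\<lambda>x. \<bar>G u x\<bar> powr p / \<bar>v u\<bar> powr p)"
      using int[OF u(1)] by simp
    show "AE x in M. norm (indicat_real (S v) x) \<le> norm (\<bar>G u x\<bar> powr p / \<bar>v u\<bar> powr p)"
      using u by (auto simp: S_def indicator_def)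
  qed (use S in simp)
  have term_int: "integrable M (\<lambda>x. \<bar>v y - v z\<bar> powr p * indicat_real (S v) x)"
    if yz: "y \<in> Y" "z \<in> Y" for v y z
  proof (cases "v y = v z")
    case False
    then have "v y \<noteq> 0 \<or> v z \<noteq> 0" by auto
    then show ?thesis using ind yz by (auto intro!: integrable_mult_right)
  qed (use \<open>p > 0\<close> in simp)
  have "(LINT x|M. \<bar>G y x - G z x\<bar> powr p) = (\<Sum>v\<in>?V. measure M (S v) * \<bar>v y - v z\<bar> powr p)"
    if yz: "y \<in> Y" "z \<in> Y" for y z
  proof -
    have "\<bar>G y x - G z x\<bar> powr p = (\<Sum>v\<in>?V. \<bar>v y - v z\<bar> powr p * indicat_real (S v) x)"
      if x: "x \<in> space M" for x
    proof -
      have "(\<Sum>v\<in>?V. \<bar>v y - v z\<bar> powr p * indicat_real (S v) x)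
          = (\<Sum>v\<in>?V. if v = g x then \<bar>v y - v z\<bar> powr p else 0)"
      proof (rule sum.cong)
        fix v assume "v \<in> ?V"
        then have "v \<in> extensional Y" by (auto simp: g_def)
        then have "x \<in> S v \<longleftrightarrow> v = g x"
          using x by (auto simp: S_def g_def extensional_def fun_eq_iff)
        then show "\<bar>v y - v z\<bar> powr p * indicat_real (S v) x = (if v = g x then \<bar>v y - v z\<bar> powr p else 0)"
          by (auto simp: indicator_def)
      qed simp
      also have "\<dots> = \<bar>G y x - G z x\<bar> powr p"
        using V x yz by (subst sum.delta) (auto simp: g_def)
      finally show ?thesis by simp
    qed
    then have "(LINT x|M. \<bar>G y x - G z x\<bar> powr p)
        = (LINT x|M. (\<Sum>v\<in>?V. \<bar>v y - v z\<bar> powr p * indicat_real (S v) x))"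
      by (intro Bochner_Integration.integral_cong) auto
    also have "\<dots> = (\<Sum>v\<in>?V. LINT x|M. \<bar>v y - v z\<bar> powr p * indicat_real (S v) x)"
      by (intro Bochner_Integration.integral_sum term_int yz)
    also have "\<dots> = (\<Sum>v\<in>?V. measure M (S v) * \<bar>v y - v z\<bar> powr p)"
      using S by (simp add: mult.commute)
    finally show ?thesis .
  qed
  then show ?thesis by (intro power_coneI[OF \<open>p > 0\<close> V, of "\<lambda>v. measure M (S v)"]) auto
qed

text \<open>Provides the dominating function for approximants bounded by twice the limit. The 4
  comes from \<open>2 * \<bar>c\<bar> + 2 * \<bar>d\<bar> \<le> 4 * max \<bar>c\<bar>
  \<bar>d\<bar>\<close>.\<close>

lemma powr_abs_diff_le:
  fixes a b c d p :: real
  assumes "p > 0" "\<bar>a\<bar> \<le> 2 * \<bar>c\<bar>" "\<bar>b\<bar> \<le> 2 * \<bar>d\<bar>"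
  shows "\<bar>a - b\<bar> powr p \<le> 4 powr p * (\<bar>c\<bar> powr p + \<bar>d\<bar> powr p)"
proof -
  have "\<bar>a - b\<bar> \<le> 4 * max \<bar>c\<bar> \<bar>d\<bar>" using assms by linarith
  then have "\<bar>a - b\<bar> powr p \<le> (4 * max \<bar>c\<bar> \<bar>d\<bar>) powr p"
    using \<open>p > 0\<close> by (intro powr_mono2) auto
  also have "\<dots> = 4 powr p * max \<bar>c\<bar> \<bar>d\<bar> powr p"
    by (simp add: powr_mult)
  also have "\<dots> \<le> 4 powr p * (\<bar>c\<bar> powr p + \<bar>d\<bar> powr p)"
    by (intro mult_left_mono) (auto simp: max_def)
  finally show ?thesis .
qed

text \<open>Simple functions converge pointwise to the \<open>f y\<close> with a factor 2
  domination; dominated convergence carries their distances to the limit, and the cone is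
  closed.\<close>

lemma Lp_distances_in_power_cone:
  fixes f :: "'y \<Rightarrow> 'c \<Rightarrow> real"
  assumes "p > 0" "finite Y" and f: "\<And>y. y \<in> Y \<Longrightarrow> f y \<in> borel_measurable M"
    and int: "\<And>y. y \<in> Y \<Longrightarrow> integrable M (\<lambda>x. \<bar>f y x\<bar> powr p)"
  shows "(\<lambda>y z. LINT x|M. \<bar>f y x - f z x\<bar> powr p) \<in> power_cone p Y"
proof -
  have "\<exists>F. (\<forall>i :: nat. simple_function M (F i)) \<and> (\<forall>x\<in>space M. (\<lambda>i. F i x) \<longlonglongrightarrow> f y x) \<and>
      (\<forall>i. \<forall>x\<in>space M. \<bar>F i x\<bar> \<le> 2 * \<bar>f y x\<bar>)" if "y \<in> Y" for y
    using borel_measurable_implies_sequence_metric[OF f[OF that], of 0] by simp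
  then have "\<exists>F. \<forall>y\<in>Y. (\<forall>i :: nat. simple_function M (F y i)) \<and>
      (\<forall>x\<in>space M. (\<lambda>i. F y i x) \<longlonglongrightarrow> f y x) \<and>
      (\<forall>i. \<forall>x\<in>space M. \<bar>F y i x\<bar> \<le> 2 * \<bar>f y x\<bar>)"
    by (intro bchoice) blast
  then obtain F where F: "\<And>y i. y \<in> Y \<Longrightarrow> simple_function M (F y (i :: nat))"
    "\<And>y x. y \<in> Y \<Longrightarrow> x \<in> space M \<Longrightarrow> (\<lambda>i. F y i x) \<longlonglongrightarrow> f y x"
    "\<And>y i x. y \<in> Y \<Longrightarrow> x \<in> space M \<Longrightarrow> \<bar>F y i x\<bar> \<le> 2 * \<bar>f y x\<bar>"
    by blast
  have Fm: "F y i \<in> borel_measurable M" if "y \<in> Y" for y i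
    using F(1)[OF that] by (rule borel_measurable_simple_function)
  have "(\<lambda>y z. LINT x|M. \<bar>F y i x - F z i x\<bar> powr p) \<in> power_cone p Y" for i
  proof (rule simple_function_distances_in_power_cone[OF assms(1,2) F(1)])
    fix y assume y: "y \<in> Y"
    show "integrable M (\<lambda>x. \<bar>F y i x\<bar> powr p)"
    proof (rule Bochner_Integration.integrable_bound)
      \<comment> \<open>With 0 as second function the difference estimate bounds
        \<open>F y i\<close> alone.\<close>
      show "integrable M (\<lambda>x. 4 powr p * (\<bar>f y x\<bar> powr p + \<bar>0\<bar> powr p))"
        using int[OF y] \<open>p > 0\<close> by simp
      show "AE x in M. norm (\<bar>F y i x\<bar> powr p) \<le> norm (4 powr p * (\<bar>f y x\<bar> powr p + \<bar>0\<bar> powr p))"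
        using powr_abs_diff_le[OF \<open>p > 0\<close> F(3)[OF y], of _ 0 0 i] by (intro AE_I2) auto
    qed (use Fm[OF y] in measurable)
  qed
  moreover have "(\<lambda>i. LINT x|M. \<bar>F y i x - F z i x\<bar> powr p) \<longlonglongrightarrow> (LINT x|M. \<bar>f y x - f z x\<bar> powr p)"
    if yz: "y \<in> Y" "z \<in> Y" for y z
  proof (rule integral_dominated_convergence)
    show "integrable M (\<lambda>x. 4 powr p * (\<bar>f y x\<bar> powr p + \<bar>f z x\<bar> powr p))"
      using int yz by simp
    show "AE x in M. (\<lambda>i. \<bar>F y i x - F z i x\<bar> powr p) \<longlonglongrightarrow> \<bar>f y x - f z x\<bar> powr p"
      using F(2) yz \<open>p > 0\<close> by (intro AE_I2 tendsto_powr' tendsto_intros) auto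
    show "AE x in M. norm (\<bar>F y i x - F z i x\<bar> powr p)
        \<le> 4 powr p * (\<bar>f y x\<bar> powr p + \<bar>f z x\<bar> powr p)" for i
      using powr_abs_diff_le[OF \<open>p > 0\<close>] F(3) yz by (intro AE_I2) auto
    show "(\<lambda>x. \<bar>f y x - f z x\<bar> powr p) \<in> borel_measurable M"
      using f[OF yz(1)] f[OF yz(2)] by measurable
    show "(\<lambda>x. \<bar>F y i x - F z i x\<bar> powr p) \<in> borel_measurable M" for i
      using Fm[OF yz(1)] Fm[OF yz(2)] by measurable
  qed
  ultimately show ?thesis by (rule power_cone_closed[OF assms(1,2)])
qed

section \<open>Disjoint sets and atoms\<close>

text \<open>If some length is not attained, a disjoint family of maximal length can neither be
  extended by a set missing its union nor refined by two disjoint sets inside one member. Its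
  members are then atoms relative to \<open>\<G>\<close>.\<close>

lemma disjoint_sets_dichotomy:
  fixes \<G> :: "'c set set"
  obtains (many) "\<forall>m :: nat. \<exists>A. disjoint_family_on A {..<m} \<and> A ` {..<m} \<subseteq> \<G>"
    | (few) m :: nat and A where "disjoint_family_on A {..<m}" "A ` {..<m} \<subseteq> \<G>"
      "\<And>S. S \<in> \<G> \<Longrightarrow> S \<inter> (\<Union>i<m. A i) \<noteq> {}"
      "\<And>j S T. j < m \<Longrightarrow> S \<in> \<G> \<Longrightarrow> T \<in> \<G> \<Longrightarrow> S \<union> T \<subseteq> A j \<Longrightarrow> S \<inter> T \<noteq> {}"
proof (cases "\<forall>m :: nat. \<exists>A. disjoint_family_on A {..<m} \<and> A ` {..<m} \<subseteq> \<G>")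
  case True
  then show thesis by (rule many)
next
  case False
  let ?P = "\<lambda>m :: nat. \<exists>A. disjoint_family_on A {..<m} \<and> A ` {..<m} \<subseteq> \<G>"
  from False obtain n where "\<not> ?P n" by blast
  moreover have "?P 0" by (simp add: disjoint_family_on_def)
  \<comment> \<open>Length 0 is attained by the empty family, so there is a last length before the
    first failure.\<close>
  ultimately have "\<exists>m<n. (\<forall>i\<le>m. \<not> \<not> ?P i) \<and> \<not> ?P (Suc m)"
    by (intro ex_least_nat_less) simp_all
  then obtain m where "?P m" and max: "\<not> ?P (Suc m)"
    by blast
  then obtain A where A: "disjoint_family_on A {..<m}" "A ` {..<m} \<subseteq> \<G>" by blast
  have dis: "A i \<inter> A j = {}" if "i < m" "j < m" "i \<noteq> j" for i j
    using A(1) that by (auto simp: disjoint_family_on_def)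
  have ext: False if "disjoint_family_on B {..<Suc m}" "\<And>i. i < Suc m \<Longrightarrow> B i \<in> \<G>" for B
    using max that by blast
  have "S \<inter> (\<Union>i<m. A i) \<noteq> {}" if S: "S \<in> \<G>" for S
  proof
    assume "S \<inter> (\<Union>i<m. A i) = {}"
    then have "disjoint_family_on (A(m := S)) {..<Suc m}"
      unfolding disjoint_family_on_def using dis by (auto simp: less_Suc_eq; blast)
    then show False by (rule ext) (use A(2) S in \<open>auto simp: less_Suc_eq\<close>)
  qed
  moreover have "S \<inter> T \<noteq> {}" if j: "j < m" and ST: "S \<in> \<G>" "T \<in> \<G>" "S \<union> T \<subseteq> A j" for j S T
  proof
    assume "S \<inter> T = {}"
    \<comment> \<open>\<open>S\<close> replaces \<open>A j\<close>, and \<open>T\<close> takes the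
      new index \<open>m\<close>.\<close>
    then have "disjoint_family_on (A(j := S, m := T)) {..<Suc m}"
      unfolding disjoint_family_on_def using dis j ST(3) by (auto simp: less_Suc_eq; blast)
    then show False by (rule ext) (use A(2) ST in \<open>auto simp: less_Suc_eq\<close>)
  qed
  ultimately show thesis by (rule few[OF A])
qed

text \<open>On an atom each threshold \<open>t\<close> is either an a.e. lower bound of
  \<open>f\<close> or an a.e. strict upper bound, so the supremum of the lower bounds is the a.e.
  value.\<close>

lemma AE_const_on_atom:
  fixes f :: "'c \<Rightarrow> real"
  assumes A: "A \<in> sets M" "A \<notin> null_sets M"
    and atom: "\<And>S. S \<in> sets M \<Longrightarrow> S \<subseteq> A \<Longrightarrow> S \<in> null_sets M \<or> A - S \<in> null_sets M"
    and f[measurable]: "f \<in> borel_measurable M"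
  shows "\<exists>c. AE x in M. x \<in> A \<longrightarrow> f x = c"
proof -
  note A(1)[measurable]
  define L where "L t \<longleftrightarrow> (AE x in M. x \<in> A \<longrightarrow> f x \<ge> t)" for t
  have not_AE: "\<not> (AE x in M. x \<notin> A)"
    using A AE_iff_null_sets by blast
  have up: "AE x in M. x \<in> A \<longrightarrow> f x < t" if "\<not> L t" for t
  proof -
    have "{x\<in>space M. x \<in> A \<and> f x < t} \<notin> null_sets M"
      using that unfolding L_def by (subst (asm) AE_iff_null) (auto simp: not_le)
    moreover have "{x\<in>space M. x \<in> A \<and> f x < t} \<in> sets M" by measurable
    ultimately have "A - {x\<in>space M. x \<in> A \<and> f x < t} \<in> null_sets M"
      using atom by blast
    then have "AE x in M. x \<notin> A - {x\<in>space M. x \<in> A \<and> f x < t}" by (rule AE_not_in)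
    then show ?thesis by eventually_elim (use sets.sets_into_space[OF A(1)] in auto)
  qed
  \<comment> \<open>Otherwise \<open>f\<close> would lie below every \<open>- real n\<close> a.e. on
    the non-null set \<open>A\<close>. Together with the analogous bound from above, this makes the
    supremum meaningful.\<close>
  have "\<exists>n :: nat. L (- real n)"
  proof (rule ccontr)
    assume "\<not> ?thesis"
    then have "AE x in M. \<forall>n :: nat. x \<in> A \<longrightarrow> f x < - real n" using up unfolding AE_all_countable by blast
    then have "AE x in M. x \<notin> A"
    proof eventually_elim
      case (elim x)
      obtain n :: nat where "- f x < real n" using reals_Archimedean2 by blast
      then show ?case using elim by (metis minus_less_iff not_less_iff_gr_or_eq)
    qed
    then show False using not_AE by blast
  qed
  then obtain t0 where t0: "L t0" by blast
  have "\<exists>n :: nat. \<not> L (real n)"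
  proof (rule ccontr)
    assume "\<not> ?thesis"
    then have "AE x in M. \<forall>n :: nat. x \<in> A \<longrightarrow> f x \<ge> real n" unfolding AE_all_countable L_def by blast
    then have "AE x in M. x \<notin> A"
    proof eventually_elim
      case (elim x)
      obtain n :: nat where "f x < real n" using reals_Archimedean2 by blast
      then show ?case using elim by (metis not_less)
    qed
    then show False using not_AE by blast
  qed
  then obtain t1 where t1: "\<not> L t1" by blast
  have mono: "L s" if "L t" "s \<le> t" for s t
    using that unfolding L_def by (auto elim!: eventually_mono)
  have bdd: "bdd_above {t. L t}"
    using mono t1 by (intro bdd_aboveI[of _ t1]) (metis mem_Collect_eq linorder_le_cases)
  define c where "c = Sup {t. L t}"
  have low: "L (c - inverse (real (Suc n)))" for n
  proof -
    have "c - inverse (real (Suc n)) < Sup {t. L t}" by (simp add: c_def)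
    then obtain t where "L t" "c - inverse (real (Suc n)) < t"
      using less_cSup_iff[of "{t. L t}"] bdd t0 by auto
    then show ?thesis using mono by simp
  qed
  have high: "\<not> L (c + inverse (real (Suc n)))" for n
  proof
    assume "L (c + inverse (real (Suc n)))"
    then have "c + inverse (real (Suc n)) \<le> c"
      unfolding c_def using bdd by (intro cSup_upper) auto
    then show False by (simp add: not_le del: of_nat_Suc)
  qed
  \<comment> \<open>Thresholds at distance 1/(n+1) from \<open>c\<close> leave only countably many
    null sets to discard.\<close>
  have "AE x in M. \<forall>n. x \<in> A \<longrightarrow> f x \<ge> c - inverse (real (Suc n))"
    using low unfolding L_def AE_all_countable by blast
  moreover have "AE x in M. \<forall>n. x \<in> A \<longrightarrow> f x < c + inverse (real (Suc n))"
    using up[OF high] unfolding AE_all_countable by blast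
  ultimately have "AE x in M. x \<in> A \<longrightarrow> f x = c"
  proof eventually_elim
    case (elim x)
    have "\<bar>f x - c\<bar> \<le> inverse (real (Suc n))" if "x \<in> A" for n
      using elim that by (smt (verit))
    then have "\<bar>f x - c\<bar> \<le> 0" if "x \<in> A"
      using that LIMSEQ_le_const[OF LIMSEQ_inverse_real_of_nat] by blast
    then show ?case by auto
  qed
  then show ?thesis by blast
qed

section \<open>Step functions over a disjoint family\<close>

definition step_fun :: "nat \<Rightarrow> (nat \<Rightarrow> 'c set) \<Rightarrow> (nat \<Rightarrow> real) \<Rightarrow> 'c \<Rightarrow> real" where
  "step_fun m A c x = (\<Sum>j<m. c j * indicator (A j) x)"

lemma step_fun_in:
  assumes "disjoint_family_on A {..<m}" "j < m" "x \<in> A j"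
  shows "step_fun m A c x = c j"
proof -
  have "x \<in> A i \<longleftrightarrow> i = j" if "i < m" for i
    using assms that by (auto simp: disjoint_family_on_def)
  then have "step_fun m A c x = (\<Sum>i<m. if i = j then c i else 0)"
    unfolding step_fun_def by (intro sum.cong) (auto simp: indicator_def)
  then show ?thesis using \<open>j < m\<close> by simp
qed

lemma step_fun_outside: "x \<notin> (\<Union>j<m. A j) \<Longrightarrow> step_fun m A c x = 0"
  unfolding step_fun_def by (intro sum.neutral) (auto simp: indicator_def)

lemma step_fun_diff: "step_fun m A c x - step_fun m A d x = step_fun m A (\<lambda>j. c j - d j) x"
  by (simp add: step_fun_def left_diff_distrib sum_subtractf)

lemma borel_measurable_step_fun:
  "(\<And>j. j < m \<Longrightarrow> A j \<in> sets M) \<Longrightarrow> step_fun m A c \<in> borel_measurable M"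
  unfolding step_fun_def by (intro borel_measurable_sum borel_measurable_times) auto

lemma AE_eq_step_fun:
  assumes A: "disjoint_family_on A {..<m}"
    and const: "\<And>j. j < m \<Longrightarrow> \<exists>c. AE x in M. x \<in> A j \<longrightarrow> f x = c"
    and outside: "AE x in M. x \<notin> (\<Union>j<m. A j) \<longrightarrow> f x = 0"
  shows "\<exists>c. AE x in M. f x = step_fun m A c x"
proof -
  have "\<exists>c. \<forall>j\<in>{..<m}. AE x in M. x \<in> A j \<longrightarrow> f x = c j"
    using const by (intro bchoice) auto
  then obtain c where "\<forall>j\<in>{..<m}. AE x in M. x \<in> A j \<longrightarrow> f x = c j" by blast
  then have "AE x in M. \<forall>j\<in>{..<m}. x \<in> A j \<longrightarrow> f x = c j"
    by (intro AE_finite_allI) auto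
  with outside have "AE x in M. f x = step_fun m A c x"
  proof eventually_elim
    case (elim x)
    then show ?case
      using step_fun_in[OF A] step_fun_outside[of x A m c] by (cases "x \<in> (\<Union>j<m. A j)") auto
  qed
  then show ?thesis by blast
qed

section \<open>Functions in place of almost-everywhere classes\<close>

abbreviation Lp_diff :: "ennreal \<Rightarrow> 'c measure \<Rightarrow> ('c \<Rightarrow> real) \<Rightarrow> ('c \<Rightarrow> real) \<Rightarrow> real" where
  "Lp_diff p M f g \<equiv> Lp_norm p M (\<lambda>x. f x - g x)"

text \<open>Choosing representatives and forming classes both preserve distances, so it suffices to
  treat functions with the pseudometric \<open>Lp_diff\<close>.\<close>

lemma property_U_Lp_spaceI:
  assumes "property_U (Lp_functions p M) (Lp_diff p M)"
  shows "property_U (Lp_space p M) (Lp_dist p M)"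
proof (rule property_U_transfer[OF assms])
  have "(SOME f. f \<in> B) \<in> Lp_functions p M" if "B \<in> Lp_space p M" for B
  proof -
    have "B \<noteq> {}" "B \<subseteq> Lp_functions p M"
      using that in_quotient_imp_non_empty[OF equiv_Lp_rel] in_quotient_imp_subset[OF equiv_Lp_rel]
      unfolding Lp_space_def by blast+
    then show ?thesis using some_in_eq[of B] by blast
  qed
  then show "(\<lambda>B. SOME f. f \<in> B) \<in> Lp_space p M \<rightarrow> Lp_functions p M" by blast
  show "(\<lambda>f. Lp_rel p M `` {f}) \<in> Lp_functions p M \<rightarrow> Lp_space p M"
    by (auto simp: Lp_space_def intro: quotientI)
qed (simp_all only: Lp_dist_class, simp only: Lp_dist_def)

text \<open>Once every function is a.e. a step function over the same sets, the coefficients are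
  coordinates of a finite-dimensional space. \<open>N\<close> is the norm as a formula in the
  coefficients.\<close>

lemma property_U_Lp_functions_step:
  assumes mem: "\<And>c. step_fun m A c \<in> Lp_functions p M"
    and rep: "\<And>f. f \<in> Lp_functions p M \<Longrightarrow> \<exists>c. AE x in M. f x = step_fun m A c x"
    and N: "\<And>c. Lp_norm p M (step_fun m A c) = N c"
    and hom: "\<And>t a. t > 0 \<Longrightarrow> N (\<lambda>j. t * a j) = t * N a"
    and definite: "\<And>a j. N a = 0 \<Longrightarrow> j < m \<Longrightarrow> a j = 0"
    and cont: "\<And>a l. (\<And>j. j < m \<Longrightarrow> (\<lambda>n. a n j) \<longlonglongrightarrow> l j) \<Longrightarrow> (\<lambda>n. N (a n)) \<longlonglongrightarrow> N l"
  shows "property_U (Lp_functions p M) (Lp_diff p M)"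
proof -
  obtain c where c: "\<And>f. f \<in> Lp_functions p M \<Longrightarrow> AE x in M. f x = step_fun m A (c f) x"
    using rep by metis
  have meas: "f \<in> borel_measurable M" if "f \<in> Lp_functions p M" for f
    using that by (simp add: Lp_functions_def)
  have diff: "Lp_diff p M (step_fun m A a) (step_fun m A b) = N (\<lambda>j. a j - b j)" for a b
    using N[of "\<lambda>j. a j - b j"] by (simp add: step_fun_diff)
  have "property_U UNIV (\<lambda>a b. N (\<lambda>j. a j - b j))"
  proof (rule property_U_finite_dim)
    show "finite {..<m}" by simp
    show "0 \<le> N a" for a unfolding N[symmetric] by (simp add: Lp_norm_def)
  qed (use hom definite cont in auto)
  then show ?thesis
  proof (rule property_U_transfer)
    fix f g assume fg: "f \<in> Lp_functions p M" "g \<in> Lp_functions p M"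
    have "Lp_diff p M f g = Lp_diff p M (step_fun m A (c f)) (step_fun m A (c g))"
    proof (rule Lp_norm_cong_AE)
      show "AE x in M. f x - g x = step_fun m A (c f) x - step_fun m A (c g) x"
        using c[OF fg(1)] c[OF fg(2)] by eventually_elim simp
    qed (intro borel_measurable_diff meas mem fg)+
    then show "N (\<lambda>j. c f j - c g j) = Lp_diff p M f g" by (simp add: diff)
  qed (use mem diff in auto)
qed

section \<open>The space $L_\infty(\mu)$\<close>

text \<open>As each \<open>A j\<close> is non-null, the essential supremum sees every
  \<open>\<bar>c j\<bar>\<close>. The inserted 0 covers \<open>m = 0\<close> and the value outside
  the union.\<close>

lemma Linf_norm_step_fun:
  assumes A: "disjoint_family_on A {..<m}" "\<And>j. j < m \<Longrightarrow> A j \<in> sets M - null_sets M"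
  shows "esssup M (\<lambda>x. ennreal \<bar>step_fun m A c x\<bar>) = ennreal (Max (insert 0 ((\<lambda>j. \<bar>c j\<bar>) ` {..<m})))"
    (is "?E = ennreal ?N")
proof (rule antisym)
  have [measurable]: "step_fun m A c \<in> borel_measurable M"
    using A(2) by (intro borel_measurable_step_fun) auto
  have N: "finite (insert 0 ((\<lambda>j. \<bar>c j\<bar>) ` {..<m}))" by simp
  show "?E \<le> ennreal ?N"
  proof (intro esssup_I AE_I2 ennreal_leI)
    fix x
    show "\<bar>step_fun m A c x\<bar> \<le> ?N"
    proof (cases "x \<in> (\<Union>j<m. A j)")
      case True
      then obtain j where "j < m" "x \<in> A j" by blast
      then show ?thesis using step_fun_in[OF A(1), of j x c] by (intro Max_ge[OF N]) auto
    qed (simp add: step_fun_outside N)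
  qed measurable
  have "?N \<in> insert 0 ((\<lambda>j. \<bar>c j\<bar>) ` {..<m})" using N by (rule Max_in) simp
  moreover have "ennreal \<bar>c j\<bar> \<le> ?E" if j: "j < m" for j
  proof (rule ccontr)
    assume "\<not> ?thesis"
    moreover have "AE x in M. ennreal \<bar>step_fun m A c x\<bar> \<le> ?E" by (rule esssup_AE)
    ultimately have "AE x in M. x \<notin> A j"
      by (elim eventually_mono) (use step_fun_in[OF A(1) j] in auto)
    then show False using A(2)[OF j] AE_iff_null_sets by blast
  qed
  ultimately show "ennreal ?N \<le> ?E" by auto
qed

lemma tendsto_Max_insert_0:
  fixes a :: "nat \<Rightarrow> 'j \<Rightarrow> real"
  assumes "finite J" "\<And>j. j \<in> J \<Longrightarrow> (\<lambda>n. a n j) \<longlonglongrightarrow> l j"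
  shows "(\<lambda>n. Max (insert 0 (a n ` J))) \<longlonglongrightarrow> Max (insert 0 (l ` J))"
  using assms
proof (induction J rule: finite_induct)
  case (insert j J)
  have "Max (insert 0 (b ` insert j J)) = max (b j) (Max (insert 0 (b ` J)))" for b :: "'j \<Rightarrow> real"
    using Max_insert[of "insert 0 (b ` J)" "b j"] insert.hyps by (simp add: insert_commute)
  then show ?case using insert by (simp add: tendsto_max)
qed simp

lemma property_U_Linf: "property_U (Lp_functions \<infinity> M) (Lp_diff \<infinity> M)"
proof -
  let ?G = "sets M - null_sets M"
  let ?N = "\<lambda>m c. Max (insert 0 ((\<lambda>j. \<bar>c j\<bar>) ` {..<m :: nat})) :: real"
  have mem: "step_fun m A c \<in> Lp_functions \<infinity> M" and norm: "Lp_norm \<infinity> M (step_fun m A c) = ?N m c"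
    if A: "disjoint_family_on A {..<m}" "A ` {..<m} \<subseteq> ?G" for m A c
  proof -
    have A': "\<And>j. j < m \<Longrightarrow> A j \<in> ?G" using A(2) by auto
    have "step_fun m A c \<in> borel_measurable M"
      using A' by (intro borel_measurable_step_fun) auto
    then show "step_fun m A c \<in> Lp_functions \<infinity> M"
      by (simp add: Lp_functions_def Linf_norm_step_fun[OF A(1) A'])
    have "?N m c \<ge> 0" by simp
    then show "Lp_norm \<infinity> M (step_fun m A c) = ?N m c"
      by (simp add: Lp_norm_def Linf_norm_step_fun[OF A(1) A'])
  qed
  show ?thesis
  proof (cases rule: disjoint_sets_dichotomy[of ?G])
    case many
    show ?thesis unfolding property_U_def
    proof (intro allI impI)
      fix Y :: "nat set" and dY
      assume Y: "Metric_space Y dY" "finite Y"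
      interpret Metric_space Y dY by fact
      let ?m = "card Y"
      obtain A where A: "disjoint_family_on A {..<?m}" "A ` {..<?m} \<subseteq> ?G"
        using many by blast
      obtain h where h: "bij_betw h {..<?m} Y"
        using ex_bij_betw_nat_finite[OF Y(2)] by (auto simp: lessThan_atLeast0)
      \<comment> \<open>The Frechet embedding: the value on the j-th set is the distance to the j-th
        point of \<open>Y\<close>.\<close>
      define \<psi> where "\<psi> y = step_fun ?m A (\<lambda>j. dY y (h j))" for y
      have "Lp_diff \<infinity> M (\<psi> y) (\<psi> z) = dY y z" if yz: "y \<in> Y" "z \<in> Y" for y z
      proof -
        have "Lp_diff \<infinity> M (\<psi> y) (\<psi> z) = ?N ?m (\<lambda>j. dY y (h j) - dY z (h j))"
          unfolding \<psi>_def step_fun_diff by (rule norm[OF A])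
        also have "\<dots> = dY y z"
        proof (rule Max_eqI)
          show "dY y z \<in> insert 0 ((\<lambda>j. \<bar>dY y (h j) - dY z (h j)\<bar>) ` {..<?m})"
          proof -
            \<comment> \<open>At the index of \<open>z\<close> the difference is
              \<open>dY y z - dY z z = dY y z\<close>, so the bound from the triangle inequality is
              attained.\<close>
            have "z \<in> h ` {..<?m}" using h yz(2) by (simp add: bij_betw_def)
            then obtain j where "j < ?m" "h j = z" by blast
            then show ?thesis using yz by (intro insertI2 image_eqI[of _ _ j]) auto
          qed
          fix r assume "r \<in> insert 0 ((\<lambda>j. \<bar>dY y (h j) - dY z (h j)\<bar>) ` {..<?m})"
          moreover have "\<bar>dY y w - dY z w\<bar> \<le> dY y z" if "w \<in> Y" for w
            using triangle[OF yz that] triangle[OF yz(2,1) that] commute[of y z] by linarith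
          moreover have "h j \<in> Y" if "j < ?m" for j using h that by (auto simp: bij_betw_def)
          ultimately show "r \<le> dY y z" by auto
        qed simp
        finally show ?thesis .
      qed
      then show "embeds_isometrically Y dY (Lp_functions \<infinity> M) (Lp_diff \<infinity> M)"
        unfolding embeds_isometrically_def \<psi>_def using mem[OF A]
        by (intro bexI[of _ "\<lambda>y. step_fun ?m A (\<lambda>j. dY y (h j))"]) auto
    qed
  next
    case (few m A)
    show ?thesis
    proof (rule property_U_Lp_functions_step[of m A \<infinity> M "?N m"])
      show "step_fun m A c \<in> Lp_functions \<infinity> M" for c by (rule mem[OF few(1,2)])
      show "Lp_norm \<infinity> M (step_fun m A c) = ?N m c" for c by (rule norm[OF few(1,2)])
    next
      fix f assume f: "f \<in> Lp_functions \<infinity> M"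
      show "\<exists>c. AE x in M. f x = step_fun m A c x"
      proof (rule AE_eq_step_fun[OF few(1)])
        fix j assume j: "j < m"
        then have Aj: "A j \<in> ?G" using few(2) by auto
        show "\<exists>c. AE x in M. x \<in> A j \<longrightarrow> f x = c"
        proof (rule AE_const_on_atom)
          fix S assume "S \<in> sets M" "S \<subseteq> A j"
          \<comment> \<open>Two disjoint subsets of \<open>A j\<close> cannot both be
            non-null.\<close>
          then show "S \<in> null_sets M \<or> A j - S \<in> null_sets M"
            using few(4)[OF j, of S "A j - S"] Aj by auto
        qed (use Aj f in \<open>auto simp: Lp_functions_def\<close>)
      next
        have "space M - (\<Union>j<m. A j) \<in> sets M" using few(2) by auto
        then have "space M - (\<Union>j<m. A j) \<in> null_sets M" using few(3) by blast
        then have "AE x in M. x \<notin> space M - (\<Union>j<m. A j)" by (rule AE_not_in)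
        then show "AE x in M. x \<notin> (\<Union>j<m. A j) \<longrightarrow> f x = 0"
          using AE_space by eventually_elim auto
      qed
    next
      fix t :: real and a :: "nat \<Rightarrow> real" assume "t > 0"
      have "t * ?N m a = Max ((\<lambda>x. t * x) ` insert 0 ((\<lambda>j. \<bar>a j\<bar>) ` {..<m}))"
        by (rule mono_Max_commute) (use \<open>t > 0\<close> in \<open>auto intro: monoI\<close>)
      then show "?N m (\<lambda>j. t * a j) = t * ?N m a"
        using \<open>t > 0\<close> by (simp add: image_image abs_mult)
    next
      fix a :: "nat \<Rightarrow> real" and j assume "?N m a = 0" "j < m"
      moreover have "\<bar>a j\<bar> \<le> ?N m a" using \<open>j < m\<close> by (intro Max_ge) auto
      ultimately show "a j = 0" by simp
    next
      fix a :: "nat \<Rightarrow> nat \<Rightarrow> real" and l assume "\<And>j. j < m \<Longrightarrow> (\<lambda>n. a n j) \<longlonglongrightarrow> l j"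
      then show "(\<lambda>n. ?N m (a n)) \<longlonglongrightarrow> ?N m l"
        by (intro tendsto_Max_insert_0 tendsto_rabs) auto
    qed
  qed
qed

section \<open>The spaces $L_p(\mu)$ for $p < \infty$\<close>

text \<open>At each point at most one indicator is nonzero, so the power can be taken on the
  coefficients.\<close>

lemma integral_step_fun_powr:
  assumes "q > 0" and A: "disjoint_family_on A {..<m}"
    "\<And>j. j < m \<Longrightarrow> A j \<in> sets M" "\<And>j. j < m \<Longrightarrow> emeasure M (A j) < \<infinity>"
  shows "integrable M (\<lambda>x. \<bar>step_fun m A c x\<bar> powr q)"
    and "(LINT x|M. \<bar>step_fun m A c x\<bar> powr q) = (\<Sum>j<m. \<bar>c j\<bar> powr q * measure M (A j))"
proof -
  have eq: "\<bar>step_fun m A c x\<bar> powr q = (\<Sum>j<m. \<bar>c j\<bar> powr q * indicat_real (A j) x)" for x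
  proof (cases "x \<in> (\<Union>j<m. A j)")
    case True
    then obtain j where j: "j < m" "x \<in> A j" by blast
    show ?thesis
      using step_fun_in[OF A(1) j, of c] step_fun_in[OF A(1) j, of "\<lambda>j. \<bar>c j\<bar> powr q"]
      by (simp add: step_fun_def)
  next
    case False
    then show ?thesis
      using step_fun_outside[OF False, of c] step_fun_outside[OF False, of "\<lambda>j. \<bar>c j\<bar> powr q"] \<open>q > 0\<close>
      by (simp add: step_fun_def)
  qed
  have int: "integrable M (\<lambda>x. \<bar>c j\<bar> powr q * indicat_real (A j) x)" if "j < m" for j
    using A(2,3)[OF that] by (intro integrable_mult_right integrable_real_indicator) auto
  show "integrable M (\<lambda>x. \<bar>step_fun m A c x\<bar> powr q)"
    unfolding eq using int by (intro Bochner_Integration.integrable_sum) auto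
  show "(LINT x|M. \<bar>step_fun m A c x\<bar> powr q) = (\<Sum>j<m. \<bar>c j\<bar> powr q * measure M (A j))"
    unfolding eq using int A(2) by (subst Bochner_Integration.integral_sum) auto
qed

lemma Lp_norm_powr:
  assumes "p \<noteq> \<infinity>" "enn2real p > 0"
  shows "Lp_norm p M f powr enn2real p = (LINT x|M. \<bar>f x\<bar> powr enn2real p)"
  using assms by (simp add: Lp_norm_def powr_powr)

lemma Lp_norm_mult:
  assumes "p \<noteq> \<infinity>" "enn2real p > 0" "t > 0"
  shows "Lp_norm p M (\<lambda>x. t * f x) = t * Lp_norm p M f"
  using assms by (simp add: Lp_norm_def abs_mult powr_mult powr_powr)

lemma property_U_Lp_finite:
  assumes p: "p \<noteq> \<infinity>" "enn2real p > 0"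
  shows "property_U (Lp_functions p M) (Lp_diff p M)"
proof -
  let ?q = "enn2real p"
  \<comment> \<open>Finite measure puts the indicators into the space; positive measure allows
    dividing by powers of it.\<close>
  let ?G = "{S\<in>sets M. 0 < emeasure M S \<and> emeasure M S < \<infinity>}"
  let ?N = "\<lambda>m A c. (\<Sum>j<m. \<bar>c j\<bar> powr ?q * measure M (A j)) powr (1 / ?q)"
  have Lp: "f \<in> Lp_functions p M \<longleftrightarrow> f \<in> borel_measurable M \<and> integrable M (\<lambda>x. \<bar>f x\<bar> powr ?q)" for f
    using p by (simp add: Lp_functions_def)
  have mem: "step_fun m A c \<in> Lp_functions p M" and norm: "Lp_norm p M (step_fun m A c) = ?N m A c"
    if A: "disjoint_family_on A {..<m}" "A ` {..<m} \<subseteq> ?G" for m A c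
  proof -
    have A': "\<And>j. j < m \<Longrightarrow> A j \<in> sets M" "\<And>j. j < m \<Longrightarrow> emeasure M (A j) < \<infinity>"
      using A(2) by auto
    show "step_fun m A c \<in> Lp_functions p M"
      unfolding Lp using borel_measurable_step_fun[OF A'(1)] integral_step_fun_powr(1)[OF p(2) A(1) A'] by auto
    show "Lp_norm p M (step_fun m A c) = ?N m A c"
      using p(1) integral_step_fun_powr(2)[OF p(2) A(1) A'] by (simp add: Lp_norm_def)
  qed
  have pos: "measure M S > 0" if "S \<in> ?G" for S
    using that by (auto simp: measure_def enn2real_positive_iff)
  show ?thesis
  proof (cases rule: disjoint_sets_dichotomy[of ?G])
    case many
    show ?thesis unfolding property_U_def
    proof (intro allI impI)
      fix Y :: "nat set" and dY
      assume Y: "Metric_space Y dY" "finite Y"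
        and emb: "\<forall>\<epsilon>>0. embeds_with_distortion Y dY (Lp_functions p M) (Lp_diff p M) (1 + \<epsilon>)"
      have sc1: "(\<lambda>x. t * f x) \<in> Lp_functions p M" if "f \<in> Lp_functions p M" for t f
        using that unfolding Lp by (auto simp: abs_mult powr_mult)
      have sc2: "Lp_diff p M (\<lambda>x. t * f x) (\<lambda>x. t * g x) = t * Lp_diff p M f g" if "t > 0" for t f g
        using Lp_norm_mult[OF p that, of M "\<lambda>x. f x - g x"] by (simp add: right_diff_distrib)
      obtain f where f: "\<And>n. f n \<in> Y \<rightarrow> Lp_functions p M"
        "\<And>y z. y \<in> Y \<Longrightarrow> z \<in> Y \<Longrightarrow> (\<lambda>n :: nat. Lp_diff p M (f n y) (f n z)) \<longlonglongrightarrow> dY y z"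
        by (rule embeds_with_distortion_limit[of Y dY "Lp_functions p M" "Lp_diff p M" "\<lambda>t f x. t * f x"])
          (use emb sc1 sc2 in blast)+
      have "(\<lambda>y z. LINT x|M. \<bar>f n y x - f n z x\<bar> powr ?q) \<in> power_cone ?q Y" for n
        using f(1)[of n] unfolding Pi_iff Lp by (intro Lp_distances_in_power_cone p Y) auto
      moreover have "(\<lambda>n. LINT x|M. \<bar>f n y x - f n z x\<bar> powr ?q) \<longlonglongrightarrow> dY y z powr ?q"
        if "y \<in> Y" "z \<in> Y" for y z
      proof -
        have "(\<lambda>n. Lp_diff p M (f n y) (f n z) powr ?q) \<longlonglongrightarrow> dY y z powr ?q"
          by (rule tendsto_powr'[OF f(2)[OF that] tendsto_const]) (use p in \<open>auto simp: Lp_norm_def\<close>)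
        then show ?thesis by (simp add: Lp_norm_powr[OF p])
      qed
      \<comment> \<open>Only the distances converge; the functions \<open>f n y\<close> themselves
        need not.\<close>
      ultimately have "(\<lambda>y z. dY y z powr ?q) \<in> power_cone ?q Y"
        by (rule power_cone_closed[OF p(2) Y(2)])
      then obtain m :: nat and a where
        a: "\<And>y z. y \<in> Y \<Longrightarrow> z \<in> Y \<Longrightarrow> dY y z powr ?q = (\<Sum>k<m. \<bar>a k y - a k z\<bar> powr ?q)"
        unfolding power_cone_def by auto
      obtain A where A: "disjoint_family_on A {..<m}" "A ` {..<m} \<subseteq> ?G"
        using many by blast
      \<comment> \<open>The divisor cancels the factor \<open>measure M (A k)\<close> in the norm of
        a step function.\<close>
      define \<psi> where "\<psi> y = step_fun m A (\<lambda>k. a k y / measure M (A k) powr (1 / ?q))" for y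
      have "Lp_diff p M (\<psi> y) (\<psi> z) = dY y z" if yz: "y \<in> Y" "z \<in> Y" for y z
      proof -
        have "Lp_diff p M (\<psi> y) (\<psi> z) = (\<Sum>k<m. \<bar>a k y / measure M (A k) powr (1 / ?q)
            - a k z / measure M (A k) powr (1 / ?q)\<bar> powr ?q * measure M (A k)) powr (1 / ?q)"
          unfolding \<psi>_def step_fun_diff by (rule norm[OF A])
        also have "(\<Sum>k<m. \<bar>a k y / measure M (A k) powr (1 / ?q)
            - a k z / measure M (A k) powr (1 / ?q)\<bar> powr ?q * measure M (A k))
            = (\<Sum>k<m. \<bar>a k y - a k z\<bar> powr ?q)"
        proof (rule sum.cong)
          fix k assume "k \<in> {..<m}"
          then have "A k \<in> ?G" using A(2) by blast
          then show "\<bar>a k y / measure M (A k) powr (1 / ?q) - a k z / measure M (A k) powr (1 / ?q)\<bar> powr ?q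
              * measure M (A k) = \<bar>a k y - a k z\<bar> powr ?q"
            using pos[of "A k"] p by (simp add: diff_divide_distrib[symmetric] powr_divide powr_powr)
        qed simp
        also have "\<dots> = dY y z powr ?q" using a[OF yz] by simp
        finally show ?thesis using p Metric_space.nonneg[OF Y(1)] by (simp add: powr_powr)
      qed
      then show "embeds_isometrically Y dY (Lp_functions p M) (Lp_diff p M)"
        unfolding embeds_isometrically_def
        by (intro bexI[of _ \<psi>]) (auto simp: \<psi>_def mem[OF A])
    qed
  next
    case (few m A)
    show ?thesis
    proof (rule property_U_Lp_functions_step[of m A p M "?N m A"])
      show "step_fun m A c \<in> Lp_functions p M" for c by (rule mem[OF few(1,2)])
      show "Lp_norm p M (step_fun m A c) = ?N m A c" for c by (rule norm[OF few(1,2)])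
    next
      fix f assume "f \<in> Lp_functions p M"
      then have f[measurable]: "f \<in> borel_measurable M" and int: "integrable M (\<lambda>x. \<bar>f x\<bar> powr ?q)"
        unfolding Lp by auto
      show "\<exists>c. AE x in M. f x = step_fun m A c x"
      proof (rule AE_eq_step_fun[OF few(1)])
        fix j assume j: "j < m"
        then have Aj: "A j \<in> ?G" using few(2) by auto
        show "\<exists>c. AE x in M. x \<in> A j \<longrightarrow> f x = c"
        proof (rule AE_const_on_atom)
          fix S assume S: "S \<in> sets M" "S \<subseteq> A j"
          \<comment> \<open>Hence non-null measurable subsets of \<open>A j\<close> belong to
            \<open>?G\<close>, and two disjoint ones are excluded by maximality.\<close>
          have "emeasure M T < \<infinity>" if "T \<subseteq> A j" for T
            using emeasure_mono[OF that, of M] Aj by (auto intro: le_less_trans)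
          then have "T \<in> ?G \<or> T \<in> null_sets M" if "T \<in> sets M" "T \<subseteq> A j" for T
            using that by (auto simp: zero_less_iff_neq_zero null_sets_def)
          from this[of S] this[of "A j - S"]
          show "S \<in> null_sets M \<or> A j - S \<in> null_sets M"
            using few(4)[OF j, of S "A j - S"] Aj S by auto
        qed (use Aj in auto)
      next
        have U: "(\<Union>j<m. A j) \<in> sets M" using few(2) by auto
        \<comment> \<open>The complement of the union need not be null, as it may have infinite
          measure. But integrability makes each \<open>S n\<close> finite in measure, so by
          maximality it is null, and the \<open>S n\<close> exhaust the points outside the union
          where \<open>f\<close> is nonzero.\<close>
        define S where "S n = {x\<in>space M. x \<notin> (\<Union>j<m. A j) \<and> inverse (real (Suc n)) \<le> \<bar>f x\<bar> powr ?q}" for n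
        have S: "S n \<in> sets M" for n unfolding S_def using U by measurable
        have "integrable M (indicat_real (S n))" for n
        proof (rule Bochner_Integration.integrable_bound)
          show "integrable M (\<lambda>x. real (Suc n) * \<bar>f x\<bar> powr ?q)" using int by (intro integrable_mult_right)
          show "AE x in M. norm (indicat_real (S n) x) \<le> norm (real (Suc n) * \<bar>f x\<bar> powr ?q)"
            by (intro AE_I2) (auto simp: S_def indicator_def field_simps)
        qed (use S in simp)
        then have fin: "emeasure M (S n) < \<infinity>" for n
          using S by (simp add: integrable_indicator_iff Int_absorb2 sets.sets_into_space)
        have "S n \<inter> (\<Union>j<m. A j) = {}" for n by (auto simp: S_def)
        then have "S n \<notin> ?G" for n using few(3) by blast
        then have "S n \<in> null_sets M" for n
          using S[of n] fin[of n] by (auto simp: zero_less_iff_neq_zero null_sets_def)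
        then have "AE x in M. \<forall>n. x \<notin> S n" unfolding AE_all_countable by (blast intro: AE_not_in)
        with AE_space show "AE x in M. x \<notin> (\<Union>j<m. A j) \<longrightarrow> f x = 0"
        proof eventually_elim
          case (elim x)
          show ?case
          proof (intro impI, rule ccontr)
            assume x: "x \<notin> (\<Union>j<m. A j)" "f x \<noteq> 0"
            then have "\<bar>f x\<bar> powr ?q > 0" by simp
            then obtain n where "inverse (real (Suc n)) < \<bar>f x\<bar> powr ?q"
              using reals_Archimedean by blast
            then have "x \<in> S n" using x elim unfolding S_def by (blast intro: less_imp_le)
            then show False using elim by blast
          qed
        qed
      qed
    next
      fix t :: real and a :: "nat \<Rightarrow> real" assume "t > 0"
      have "?N m A (\<lambda>j. t * a j) = (t powr ?q * (\<Sum>j<m. \<bar>a j\<bar> powr ?q * measure M (A j))) powr (1 / ?q)"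
        using \<open>t > 0\<close> by (simp add: abs_mult powr_mult sum_distrib_left mult.assoc)
      also have "\<dots> = t * ?N m A a"
        using \<open>t > 0\<close> p by (simp add: powr_mult powr_powr sum_nonneg)
      finally show "?N m A (\<lambda>j. t * a j) = t * ?N m A a" .
    next
      fix a :: "nat \<Rightarrow> real" and j assume "?N m A a = 0" and j: "j < m"
      then have "(\<Sum>j<m. \<bar>a j\<bar> powr ?q * measure M (A j)) = 0" by simp
      then have "\<bar>a j\<bar> powr ?q * measure M (A j) = 0"
        using j by (subst (asm) sum_nonneg_eq_0_iff) auto
      moreover have "A j \<in> ?G" using few(2) j by blast
      ultimately show "a j = 0" using pos[of "A j"] by simp
    next
      fix a :: "nat \<Rightarrow> nat \<Rightarrow> real" and l assume "\<And>j. j < m \<Longrightarrow> (\<lambda>n. a n j) \<longlonglongrightarrow> l j"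
      then show "(\<lambda>n. ?N m A (a n)) \<longlonglongrightarrow> ?N m A l"
        \<comment> \<open>Positive exponents and nonnegative bases make \<open>powr\<close>
          continuous at 0 as well.\<close>
        using p by (intro tendsto_powr' tendsto_sum tendsto_mult tendsto_rabs tendsto_const)
          (auto intro!: always_eventually sum_nonneg)
    qed
  qed
qed

section \<open>Property (U)\<close>

theorem theorem4p2:
  fixes M :: "'c measure" and p :: ennreal
  shows "((\<exists>B :: 'a::banach set. finite B \<and> span B = UNIV) \<longrightarrow> property_U (UNIV :: 'a set) dist)
       \<and> (isometrically_universal (UNIV :: 'b::banach set) dist \<longrightarrow> property_U (UNIV :: 'b set) dist)
       \<and> (1 \<le> p \<longrightarrow> property_U (Lp_space p M) (Lp_dist p M))"
proof (intro conjI impI)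
  show "property_U (UNIV :: 'a set) dist" if "\<exists>B :: 'a set. finite B \<and> span B = UNIV"
    using that property_U_finite_span by blast
  show "property_U (UNIV :: 'b set) dist" if "isometrically_universal (UNIV :: 'b set) dist"
    using that unfolding isometrically_universal_def property_U_def by blast
  show "property_U (Lp_space p M) (Lp_dist p M)" if "1 \<le> p"
  proof (cases "p = \<infinity>")
    case True
    then show ?thesis using property_U_Lp_spaceI[OF property_U_Linf] by simp
  next
    case False
    then have "enn2real p > 0"
      using that by (auto simp: enn2real_positive_iff less_top intro: less_le_trans[OF zero_less_one])
    then show ?thesis using property_U_Lp_spaceI[OF property_U_Lp_finite[OF False]] by blast
  qed
qed

end
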